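(* Let $R=\mathbb{C}\{x,y\}$ with maximal ideal $\mathbf{m}=(x,y)$, and let $f\in R$ define an isolated plane curve singularity $X:f=0$ at the origin $0\in\mathbb{C}^2$ which is not quasi-homogeneous. Let $J_f=(f_x,f_y)$, $I_f=(f_x,f_y,f)$, $\mu(f)=\dim_{\mathbb{C}}R/J_f$, $\tau(f)=\dim_{\mathbb{C}}R/I_f$, $\operatorname{Ann}(f)=\{g\in R : gf\in J_f\}$, and let $\operatorname{Fitt}_2(I_f)$ be the second Fitting ideal of the $R$-module $I_f$. Then the following hold. 1. $$\operatorname{Ann}(f)\subset\operatorname{Fitt}_2(I_f)\subset(x,y)=\mathbf{m}.$$ 2. $$\mu(f)-\tau(f)\geq\dim_{\mathbb{C}}\frac{R}{\operatorname{Fitt}_2(I_f)}.$$ In particular, the equalities hold in (1) and (2) if $\mu(f)-\tau(f)=1$.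
   Context: $R=\mathbb{C}\{x,y\}$ is the ring of convergent power series in two variables over $\mathbb{C}$; $f_x=\partial_x f$ and $f_y=\partial_y f$. That $X:f=0$ is an isolated singularity at the origin means $f(0)=0$ and $\dim_{\mathbb{C}}R/J_f<\infty$. The numbers $\mu(f)$ and $\tau(f)$ are the Milnor and Tjurina numbers. By a theorem of K. Saito, $X$ is quasi-homogeneous if and only if $I_f=J_f$ (i.e. $f\in J_f$), equivalently $\mu(f)=\tau(f)$; so "not quasi-homogeneous" means $f\notin J_f$. The syzygy module $\operatorname{Syz}(f)=\{(a,b,c)\in R^3 : af_x+bf_y+cf=0\}$ is a free $R$-module of rank $2$. If $\rho_1=(a_1,b_1,c_1)$ and $\rho_2=(a_2,b_2,c_2)$ form a basis of it, then $0\to R^2\xrightarrow{u}R^3\to I_f\to 0$ with $u(s,t)=s\rho_1+t\rho_2$ and $R^3\to I_f$, $(a,b,c)\mapsto af_x+bf_y+cf$, is a free resolution of $I_f$. The Fitting ideal $\operatorname{Fitt}_2(I_f)$ is the ideal $I_1(U)$ generated by all entries $a_1,b_1,c_1,a_2,b_2,c_2$ of the matrix $U$ of $u$ (in general, for a presentation $R^m\xrightarrow{\phi}R^n\to N\to 0$, $\operatorname{Fitt}_i(N)$ is generated by the $(n-i)$-minors of $\phi$). *)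

theory Defs
  imports
    "HOL-Analysis.Infinite_Sum"
    "HOL-Algebra.Module"
    "HOL-Algebra.QuotRing"
    "HOL-Algebra.Embedded_Algebras"
    "HOL-Combinatorics.Permutations"
begin

section \<open>Convergent power series in two variables\<close>

text \<open>
  A formal power series \<open>F\<close> in \<open>x\<close>, \<open>y\<close> is a series in \<open>x\<close> whose coefficients are series in \<open>y\<close>:
  \<open>fps_nth (fps_nth F i) j\<close> is the coefficient of \<open>x ^ i * y ^ j\<close>. It is convergent if it converges
  absolutely on some polydisc of positive radius.
\<close>

definition convergent_series :: "complex fps fps \<Rightarrow> bool" where
  "convergent_series F \<longleftrightarrow>
     (\<exists>r::real. r > 0 \<and>
       (\<lambda>(i, j). norm (fps_nth (fps_nth F i) j) * r ^ (i + j)) summable_on UNIV)"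

definition conv_ring :: "complex fps fps ring" where
  "conv_ring = \<lparr>carrier = {F. convergent_series F}, mult = (*), one = 1, zero = 0, add = (+)\<rparr>"

definition var_x :: "complex fps fps" where "var_x = fps_X"

definition var_y :: "complex fps fps" where "var_y = fps_const fps_X"

definition partial_x :: "complex fps fps \<Rightarrow> complex fps fps" where
  "partial_x F = fps_deriv F"

definition partial_y :: "complex fps fps \<Rightarrow> complex fps fps" where
  "partial_y F = Abs_fps (\<lambda>i. fps_deriv (fps_nth F i))"

definition max_ideal :: "complex fps fps set" where
  "max_ideal = Idl\<^bsub>conv_ring\<^esub> {var_x, var_y}"

definition jacobian_ideal :: "complex fps fps \<Rightarrow> complex fps fps set" where
  "jacobian_ideal f = Idl\<^bsub>conv_ring\<^esub> {partial_x f, partial_y f}"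

definition tjurina_ideal :: "complex fps fps \<Rightarrow> complex fps fps set" where
  "tjurina_ideal f = Idl\<^bsub>conv_ring\<^esub> {partial_x f, partial_y f, f}"

definition ann_ideal :: "complex fps fps \<Rightarrow> complex fps fps set" where
  "ann_ideal f = {g \<in> carrier conv_ring. g \<otimes>\<^bsub>conv_ring\<^esub> f \<in> jacobian_ideal f}"


section \<open>Complex dimension of quotients\<close>

text \<open>The image of the field of constants in the quotient by \<open>J\<close>.\<close>

definition quot_scalars :: "complex fps fps set \<Rightarrow> complex fps fps set set" where
  "quot_scalars J = range (\<lambda>c. J +>\<^bsub>conv_ring\<^esub> fps_const (fps_const c))"

definition finite_quot_dim :: "complex fps fps set \<Rightarrow> bool" where
  "finite_quot_dim J \<longleftrightarrow>
     ring.finite_dimension (conv_ring Quot J) (quot_scalars J) (carrier (conv_ring Quot J))"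

text \<open>Only meaningful if \<^term>\<open>finite_quot_dim J\<close> holds.\<close>

definition quot_dim :: "complex fps fps set \<Rightarrow> nat" where
  "quot_dim J = ring.dim (conv_ring Quot J) (quot_scalars J) (carrier (conv_ring Quot J))"

definition milnor_number :: "complex fps fps \<Rightarrow> nat" where
  "milnor_number f = quot_dim (jacobian_ideal f)"

definition tjurina_number :: "complex fps fps \<Rightarrow> nat" where
  "tjurina_number f = quot_dim (tjurina_ideal f)"

definition isolated_singularity :: "complex fps fps \<Rightarrow> bool" where
  "isolated_singularity f \<longleftrightarrow>
     f \<in> carrier conv_ring \<and> fps_nth (fps_nth f 0) 0 = 0 \<and> finite_quot_dim (jacobian_ideal f)"

text \<open>
  By K. Saito's theorem, for isolated singularities this agrees with the existence of
  coordinates in which the curve is defined by a weighted homogeneous polynomial.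
\<close>

definition quasi_homogeneous :: "complex fps fps \<Rightarrow> bool" where
  "quasi_homogeneous f \<longleftrightarrow> f \<in> jacobian_ideal f"


section \<open>Fitting ideals\<close>

text \<open>A matrix is a function of the row and the column index, both counted from \<open>0\<close>.\<close>

definition matrix_det :: "('a, 'c) ring_scheme \<Rightarrow> nat \<Rightarrow> (nat \<Rightarrow> nat \<Rightarrow> 'a) \<Rightarrow> 'a" where
  "matrix_det R k A =
     (\<Oplus>\<^bsub>R\<^esub>p\<in>{p. p permutes {..<k}}.
        (if evenperm p then \<one>\<^bsub>R\<^esub> else \<ominus>\<^bsub>R\<^esub> \<one>\<^bsub>R\<^esub>) \<otimes>\<^bsub>R\<^esub> (\<Otimes>\<^bsub>R\<^esub>i\<in>{..<k}. A i (p i)))"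

definition minors ::
  "('a, 'c) ring_scheme \<Rightarrow> nat \<Rightarrow> nat \<Rightarrow> (nat \<Rightarrow> nat \<Rightarrow> 'a) \<Rightarrow> nat \<Rightarrow> 'a set" where
  "minors R n m A k =
     {matrix_det R k (\<lambda>i j. A (r i) (c j)) | r c.
        r \<in> {..<k} \<rightarrow> {..<n} \<and> strict_mono_on {..<k} r \<and>
        c \<in> {..<k} \<rightarrow> {..<m} \<and> strict_mono_on {..<k} c}"

definition free_vectors :: "('a, 'c) ring_scheme \<Rightarrow> nat \<Rightarrow> (nat \<Rightarrow> 'a) set" where
  "free_vectors R n = {..<n} \<rightarrow>\<^sub>E carrier R"

definition matrix_map ::
  "('a, 'c) ring_scheme \<Rightarrow> nat \<Rightarrow> nat \<Rightarrow> (nat \<Rightarrow> nat \<Rightarrow> 'a) \<Rightarrow> (nat \<Rightarrow> 'a) \<Rightarrow> (nat \<Rightarrow> 'a)" where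
  "matrix_map R n m A w = (\<lambda>i\<in>{..<n}. \<Oplus>\<^bsub>R\<^esub>j\<in>{..<m}. A i j \<otimes>\<^bsub>R\<^esub> w j)"

definition generator_map ::
  "('a, 'b, 'd) module_scheme \<Rightarrow> nat \<Rightarrow> (nat \<Rightarrow> 'b) \<Rightarrow> (nat \<Rightarrow> 'a) \<Rightarrow> 'b" where
  "generator_map M n g v = (\<Oplus>\<^bsub>M\<^esub>i\<in>{..<n}. v i \<odot>\<^bsub>M\<^esub> g i)"

text \<open>
  The \<open>n\<close> by \<open>m\<close> matrix \<open>A\<close> and the elements \<open>g 0, \<dots>, g (n - 1)\<close> of \<open>M\<close> give an exact sequence
  \<open>R ^ m \<longrightarrow> R ^ n \<longrightarrow> M \<longrightarrow> 0\<close>.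
\<close>

definition presentation ::
  "('a, 'c) ring_scheme \<Rightarrow> ('a, 'b, 'd) module_scheme \<Rightarrow> nat \<Rightarrow> nat \<Rightarrow>
     (nat \<Rightarrow> nat \<Rightarrow> 'a) \<Rightarrow> (nat \<Rightarrow> 'b) \<Rightarrow> bool" where
  "presentation R M n m A g \<longleftrightarrow>
     (\<forall>i<n. \<forall>j<m. A i j \<in> carrier R) \<and>
     (\<forall>i<n. g i \<in> carrier M) \<and>
     matrix_map R n m A ` free_vectors R m =
       {v \<in> free_vectors R n. generator_map M n g v = \<zero>\<^bsub>M\<^esub>} \<and>
     generator_map M n g ` free_vectors R n = carrier M"

text \<open>
  For a finitely presented module over a commutative ring, the ideal does not depend on the
  presentation (Fitting's lemma), so the choice is immaterial. The truncated subtraction is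
  intended: for \<open>k \<ge> n\<close> the only minor is the empty one, which is \<open>1\<close>.
\<close>

definition fitting_ideal ::
  "('a, 'c) ring_scheme \<Rightarrow> ('a, 'b, 'd) module_scheme \<Rightarrow> nat \<Rightarrow> 'a set" where
  "fitting_ideal R M k =
     (SOME I. \<exists>n m A g. presentation R M n m A g \<and> I = Idl\<^bsub>R\<^esub> (minors R n m A (n - k)))"

text \<open>
  An ideal as a module over its ring. The fields \<open>mult\<close> and \<open>one\<close> of the module record play no
  role.
\<close>

definition ideal_module :: "('a, 'c) ring_scheme \<Rightarrow> 'a set \<Rightarrow> ('a, 'a) module" where
  "ideal_module R I =
     \<lparr>carrier = I, mult = mult R, one = one R, zero = zero R, add = add R, smult = mult R\<rparr>"

definition fitt2 :: "complex fps fps \<Rightarrow> complex fps fps set" where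
  "fitt2 f = fitting_ideal conv_ring (ideal_module conv_ring (tjurina_ideal f)) 2"

end

theory Submission
  imports Defs "Jordan_Normal_Form.Determinant"
begin

text \<open>
  The syzygies \<open>(a, b, c)\<close> of \<open>f\<^sub>x\<close>, \<open>f\<^sub>y\<close>, \<open>f\<close> have as third entries exactly the elements of
  \<open>Ann(f)\<close>, so \<open>Ann(f)\<close> lies in the ideal of all entries of syzygies, which is the Fitting ideal.
  If an entry were a unit, then either \<open>c\<close> is a unit and \<open>f \<in> J\<^sub>f\<close>, or \<open>a \<partial>\<^sub>x + b \<partial>\<^sub>y\<close> is a vector
  field that does not vanish at the origin and preserves \<open>I\<^sub>f\<close>; applying it repeatedly to a power
  of \<open>x\<close> or of \<open>y\<close> in \<open>I\<^sub>f\<close> gives \<open>1 \<in> I\<^sub>f\<close>, which is impossible.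

  Multiplication by \<open>f\<close> induces an isomorphism of \<open>R / Ann(f)\<close> with \<open>I\<^sub>f / J\<^sub>f\<close>, so the dimension of
  \<open>R / Ann(f)\<close> is \<open>\<mu>(f) - \<tau>(f)\<close>, and the statements about dimensions follow from the inclusions.

  Noetherianity of \<open>R\<close> is not needed to find a presentation of \<open>I\<^sub>f\<close>: \<open>Ann(f)\<close> is finitely generated
  because it contains \<open>J\<^sub>f\<close> with finite codimension, and the syzygies of \<open>f\<^sub>x\<close>, \<open>f\<^sub>y\<close> are the
  multiples of the Koszul one.
\<close>

section \<open>Convergent power series\<close>

text \<open>\<open>fitting_ideal\<close> picks some presentation by choice, so the bounds have to
  hold for every presentation of \<open>tjurina_ideal f\<close>, with any number n of generators g.
  The explicit presentation built from f_x, f_y, f only guarantees that there is something to choose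
  from. An arbitrary g is compared with these three elements by matrices P and Q that write each
  system through the other. This gives two halves of Fitting's lemma, one for each inclusion: every
  entry of a syzygy of the three elements lies in the ideal of (n - 2)-minors, and if all such
  entries vanish at the origin, then so do the (n - 2)-minors. The second half is linear algebra
  over the complex numbers after evaluation at the origin.

  Dimensions are measured in one ambient space, along the chain J_f, Ann(f), Fitt_2, R, and the
  equalities hold because the only proper ideal containing an ideal of codimension 1 is that ideal
  itself.\<close>

abbreviation coef :: "complex fps fps \<Rightarrow> nat \<Rightarrow> nat \<Rightarrow> complex" where
  "coef F i j \<equiv> fps_nth (fps_nth F i) j"

text \<open>Every finite set of index pairs lies in a square, over which the sum is a product of two
  geometric sums, each at most 2.\<close>

lemma geometric_summable_on:
  "(\<lambda>(i, j). (1/2) ^ (i + j) :: real) summable_on (UNIV :: (nat \<times> nat) set)"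
proof (rule nonneg_bdd_above_summable_on)
  show "bdd_above (sum (\<lambda>(i, j). (1/2) ^ (i + j) :: real) ` {F. F \<subseteq> UNIV \<and> finite F})"
  proof (rule bdd_aboveI2)
    fix S :: "(nat \<times> nat) set" assume S: "S \<in> {F. F \<subseteq> UNIV \<and> finite F}"
    define N where "N = Suc (Max (insert 0 (fst ` S \<union> snd ` S)))"
    have fin: "finite (insert 0 (fst ` S \<union> snd ` S))" using S by auto
    have "S \<subseteq> {..<N} \<times> {..<N}"
    proof
      fix p assume "p \<in> S"
      then have "fst p \<le> Max (insert 0 (fst ` S \<union> snd ` S))" "snd p \<le> Max (insert 0 (fst ` S \<union> snd ` S))"
        using fin by (auto intro!: Max_ge)
      then show "p \<in> {..<N} \<times> {..<N}" by (cases p) (auto simp: N_def)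
    qed
    then have "sum (\<lambda>(i, j). (1/2) ^ (i + j) :: real) S \<le> sum (\<lambda>(i, j). (1/2) ^ (i + j)) ({..<N} \<times> {..<N})"
      by (intro sum_mono2) auto
    also have "\<dots> = (\<Sum>i<N. (1/2) ^ i) * (\<Sum>j<N. (1/2) ^ j)"
      by (simp add: sum_product sum.cartesian_product power_add case_prod_beta)
    also have "\<dots> \<le> 2 * 2"
      by (intro mult_mono sum_nonneg) (auto simp: geometric_sum)
    finally show "sum (\<lambda>(i, j). (1/2) ^ (i + j) :: real) S \<le> 4" by simp
  qed
qed auto

text \<open>Geometric coefficient bounds pass through sums, products and derivatives more easily
  than summability. From a radius r, each single term is bounded by the total sum, so
  \<open>M = 1 / r\<close> works; conversely, the radius \<open>1 / (2 * M)\<close> leaves a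
  multiple of the double geometric series.\<close>

lemma convergent_series_iff:
  "convergent_series F \<longleftrightarrow> (\<exists>C M. C > 0 \<and> M > 0 \<and> (\<forall>i j. norm (coef F i j) \<le> C * M ^ (i + j)))"
proof
  assume "convergent_series F"
  then obtain r :: real where r: "r > 0"
    and s: "(\<lambda>(i, j). norm (coef F i j) * r ^ (i + j)) summable_on UNIV"
    by (auto simp: convergent_series_def)
  \<comment> \<open>The summand 1 keeps C positive when F is zero.\<close>
  define C where "C = infsum (\<lambda>(i, j). norm (coef F i j) * r ^ (i + j)) UNIV + 1"
  have le: "norm (coef F i j) * r ^ (i + j) \<le> C - 1" for i j
    using finite_sum_le_infsum[OF s, of "{(i, j)}"] r by (auto simp: C_def)
  have "C > 0" using le[of 0 0] norm_ge_zero[of "coef F 0 0"] by (simp del: norm_ge_zero)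
  moreover have "norm (coef F i j) \<le> C * (1 / r) ^ (i + j)" for i j
    using le[of i j] r by (simp add: power_divide field_simps)
  ultimately show "\<exists>C M. C > 0 \<and> M > 0 \<and> (\<forall>i j. norm (coef F i j) \<le> C * M ^ (i + j))"
    using r by (intro exI[of _ C] exI[of _ "1 / r"]) auto
next
  assume "\<exists>C M. C > 0 \<and> M > 0 \<and> (\<forall>i j. norm (coef F i j) \<le> C * M ^ (i + j))"
  then obtain C M where CM: "C > 0" "M > 0" and le: "\<And>i j. norm (coef F i j) \<le> C * M ^ (i + j)"
    by blast
  have "(\<lambda>(i, j). norm (coef F i j) * (1 / (2 * M)) ^ (i + j)) summable_on UNIV"
  proof (rule summable_on_comparison_test)
    show "(\<lambda>p. C * (\<lambda>(i, j). (1/2) ^ (i + j)) p) summable_on (UNIV :: (nat \<times> nat) set)"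
      by (intro summable_on_cmult_right geometric_summable_on)
  next
    fix p :: "nat \<times> nat"
    obtain i j where p: "p = (i, j)" by (cases p)
    have "norm (coef F i j) * (1 / (2 * M)) ^ (i + j) \<le> (C * M ^ (i + j)) * (1 / (2 * M)) ^ (i + j)"
      using CM by (intro mult_right_mono le) auto
    also have "\<dots> = C * (1/2) ^ (i + j)"
      using CM by (simp add: power_divide power_mult_distrib field_simps)
    finally show "(case p of (i, j) \<Rightarrow> norm (coef F i j) * (1 / (2 * M)) ^ (i + j))
        \<le> C * (\<lambda>(i, j). (1/2) ^ (i + j)) p" by (simp add: p)
  qed (use CM in auto)
  then show "convergent_series F"
    unfolding convergent_series_def using CM by (intro exI[of _ "1 / (2 * M)"]) auto
qed

lemma convergent_seriesI:
  assumes "\<And>i j. norm (coef F i j) \<le> C * M ^ (i + j)" "C > 0" "M > 0"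
  shows "convergent_series F"
  using assms convergent_series_iff by blast

lemma convergent_seriesE:
  assumes "convergent_series F"
  obtains C M where "C > 0" "M > 0" "\<And>i j. norm (coef F i j) \<le> C * M ^ (i + j)"
  using assms convergent_series_iff by blast

section \<open>Closure under the ring operations\<close>

lemma coef_mult:
  "coef (F * G) i j = (\<Sum>k\<le>i. \<Sum>l\<le>j. coef F k l * coef G (i - k) (j - l))"
  by (simp add: fps_mult_nth fps_sum_nth atLeast0AtMost)

lemma convergent_series_add:
  assumes "convergent_series F" "convergent_series G"
  shows "convergent_series (F + G)"
proof -
  obtain C M where CM: "C > 0" "M > 0" "\<And>i j. norm (coef F i j) \<le> C * M ^ (i + j)"
    using convergent_seriesE[OF assms(1)] by blast
  obtain D N where DN: "D > 0" "N > 0" "\<And>i j. norm (coef G i j) \<le> D * N ^ (i + j)"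
    using convergent_seriesE[OF assms(2)] by blast
  show ?thesis
  proof (rule convergent_seriesI)
    fix i j
    have "norm (coef (F + G) i j) \<le> C * M ^ (i + j) + D * N ^ (i + j)"
      using CM(3)[of i j] DN(3)[of i j] norm_triangle_ineq[of "coef F i j" "coef G i j"] by simp
    also have "\<dots> \<le> C * max M N ^ (i + j) + D * max M N ^ (i + j)"
      using CM DN by (intro add_mono mult_left_mono power_mono) auto
    finally show "norm (coef (F + G) i j) \<le> (C + D) * max M N ^ (i + j)"
      by (simp add: algebra_simps)
  qed (use CM DN in auto)
qed

lemma convergent_series_mult:
  assumes "convergent_series F" "convergent_series G"
  shows "convergent_series (F * G)"
proof -
  obtain C M where CM: "C > 0" "M > 0" "\<And>i j. norm (coef F i j) \<le> C * M ^ (i + j)"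
    using convergent_seriesE[OF assms(1)] by blast
  obtain D N where DN: "D > 0" "N > 0" "\<And>i j. norm (coef G i j) \<le> D * N ^ (i + j)"
    using convergent_seriesE[OF assms(2)] by blast
  define K where "K = max M N"
  have K: "K > 0" "M \<le> K" "N \<le> K" using CM by (auto simp: K_def)
  show ?thesis
  proof (rule convergent_seriesI)
    fix i j
    have term_le: "norm (coef F k l * coef G (i - k) (j - l)) \<le> C * D * K ^ (i + j)"
      if "k \<le> i" "l \<le> j" for k l
    proof -
      have "norm (coef F k l) \<le> C * K ^ (k + l)"
        by (rule order_trans[OF CM(3)]) (use CM K in \<open>auto intro!: mult_left_mono power_mono\<close>)
      moreover have "norm (coef G (i - k) (j - l)) \<le> D * K ^ (i - k + (j - l))"
        by (rule order_trans[OF DN(3)]) (use DN K in \<open>auto intro!: mult_left_mono power_mono\<close>)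
      ultimately have "norm (coef F k l * coef G (i - k) (j - l))
          \<le> (C * K ^ (k + l)) * (D * K ^ (i - k + (j - l)))"
        unfolding norm_mult using CM K by (intro mult_mono) auto
      also have "\<dots> = C * D * K ^ ((k + l) + (i - k + (j - l)))"
        by (simp add: power_add algebra_simps)
      also have "(k + l) + (i - k + (j - l)) = i + j" using that by simp
      finally show ?thesis .
    qed
    have "norm (coef (F * G) i j) \<le> (\<Sum>k\<le>i. \<Sum>l\<le>j. C * D * K ^ (i + j))"
      unfolding coef_mult by (intro sum_norm_le) (use term_le in auto)
    also have "\<dots> = (real (Suc i) * real (Suc j)) * (C * D * K ^ (i + j))" by simp
    \<comment> \<open>The number of terms of the Cauchy product is absorbed by doubling the growth
      rate.\<close>
    also have "\<dots> \<le> (2 ^ i * 2 ^ j) * (C * D * K ^ (i + j))"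
    proof (intro mult_right_mono mult_mono)
      have "Suc n \<le> 2 ^ n" for n :: nat by (simp add: Suc_leI)
      then have *: "real (Suc n) \<le> 2 ^ n" for n :: nat
        by (metis numeral_power_le_of_nat_cancel_iff of_nat_le_iff of_nat_numeral of_nat_power)
      show "real (Suc i) \<le> 2 ^ i" "real (Suc j) \<le> 2 ^ j" by (rule *)+
    qed (use CM DN K in auto)
    also have "\<dots> = C * D * (2 * K) ^ (i + j)" by (simp add: power_add power_mult_distrib)
    finally show "norm (coef (F * G) i j) \<le> C * D * (2 * K) ^ (i + j)" .
  qed (use CM DN K in auto)
qed

lemma convergent_series_const: "convergent_series (fps_const (fps_const c))"
  by (rule convergent_seriesI[of _ "norm c + 1" 1])
    (auto simp: add_nonneg_pos fps_nth_fps_const)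

lemma convergent_series_0: "convergent_series 0"
  and convergent_series_1: "convergent_series 1"
  using convergent_series_const[of 0] convergent_series_const[of 1] by simp_all

lemma convergent_series_uminus: "convergent_series F \<Longrightarrow> convergent_series (- F)"
  by (simp add: convergent_series_iff)

lemma convergent_series_diff:
  "convergent_series F \<Longrightarrow> convergent_series G \<Longrightarrow> convergent_series (F - G)"
  using convergent_series_add[of F "- G"] convergent_series_uminus[of G] by simp

lemma convergent_series_power: "convergent_series F \<Longrightarrow> convergent_series (F ^ n)"
  by (induction n) (auto intro: convergent_series_1 convergent_series_mult)

lemma convergent_series_sum:
  "(\<And>i. i \<in> S \<Longrightarrow> convergent_series (F i)) \<Longrightarrow> convergent_series (sum F S)"
  by (induction S rule: infinite_finite_induct)
    (auto intro: convergent_series_0 convergent_series_add)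

lemma convergent_series_prod:
  "(\<And>i. i \<in> S \<Longrightarrow> convergent_series (F i)) \<Longrightarrow> convergent_series (prod F S)"
  by (induction S rule: infinite_finite_induct)
    (auto intro: convergent_series_1 convergent_series_mult)

lemma convergent_series_var_x: "convergent_series var_x"
  by (rule convergent_seriesI[of _ 1 1]) (auto simp: var_x_def fps_X_def)

lemma convergent_series_var_y: "convergent_series var_y"
  by (rule convergent_seriesI[of _ 1 1]) (auto simp: var_y_def fps_X_def fps_nth_fps_const)

lemma convergent_series_of_nat: "convergent_series (of_nat n)"
  by (induction n) (auto intro: convergent_series_0 convergent_series_1 convergent_series_add)

section \<open>Partial derivatives, and units of the ring\<close>

lemma coef_partial_x: "coef (partial_x F) i j = of_nat (Suc i) * coef F (Suc i) j"
  by (simp add: partial_x_def fps_of_nat[symmetric] del: of_nat_Suc fps_of_nat)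

lemma coef_partial_y: "coef (partial_y F) i j = of_nat (Suc j) * coef F i (Suc j)"
  by (simp add: partial_y_def)

lemma
  assumes "convergent_series F"
  shows convergent_series_partial_x: "convergent_series (partial_x F)"
    and convergent_series_partial_y: "convergent_series (partial_y F)"
proof -
  obtain C M where CM: "C > 0" "M > 0" and le: "\<And>i j. norm (coef F i j) \<le> C * M ^ (i + j)"
    using convergent_seriesE[OF assms] by blast
  have pow2: "real (Suc k) \<le> 2 ^ n" if "k \<le> n" for k n :: nat
  proof -
    have "real (Suc k) \<le> real (Suc n)" using that by simp
    also have "\<dots> \<le> 2 ^ n" using of_nat_less_two_power[of n, where 'a=real]
      by (metis Suc_leI less_exp of_nat_le_iff of_nat_numeral of_nat_power)
    finally show ?thesis .
  qed
  \<comment> \<open>The index shift costs the factor M, and the factor from differentiation is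
    absorbed by doubling the growth rate.\<close>
  have *: "norm (of_nat (Suc k) * coef F i' j') \<le> (C * M) * (2 * M) ^ (i + j)"
    if "k \<le> i + j" "i' + j' = Suc (i + j)" for i j i' j' k
  proof -
    have "norm (of_nat (Suc k) * coef F i' j') = real (Suc k) * norm (coef F i' j')"
      by (simp only: norm_mult norm_of_nat)
    also have "\<dots> \<le> 2 ^ (i + j) * (C * M ^ (i' + j'))"
      using pow2[OF that(1)] by (intro mult_mono le) auto
    finally show ?thesis unfolding that(2) by (simp add: power_mult_distrib algebra_simps)
  qed
  show "convergent_series (partial_x F)"
    by (rule convergent_seriesI[of _ "C * M" "2 * M"])
      (auto simp only: coef_partial_x intro!: *, use CM in auto)
  show "convergent_series (partial_y F)"
    by (rule convergent_seriesI[of _ "C * M" "2 * M"])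
      (auto simp only: coef_partial_y intro!: *, use CM in auto)
qed

lemma partial_mult:
  shows "partial_x (F * G) = partial_x F * G + F * partial_x G"
    and "partial_y (F * G) = partial_y F * G + F * partial_y G"
proof -
  show "partial_x (F * G) = partial_x F * G + F * partial_x G"
    by (simp add: partial_x_def)
  show "partial_y (F * G) = partial_y F * G + F * partial_y G"
    by (rule fps_ext) (simp add: partial_y_def fps_mult_nth fps_deriv_sum sum.distrib add.commute)
qed

lemma partial_add:
  "partial_x (F + G) = partial_x F + partial_x G"
  "partial_y (F + G) = partial_y F + partial_y G"
  by (auto simp: partial_x_def partial_y_def fps_eq_iff)

lemma partial_uminus:
  "partial_x (- F) = - partial_x F"
  "partial_y (- F) = - partial_y F"
  by (auto simp: partial_x_def partial_y_def fps_eq_iff algebra_simps)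

lemma partial_commute: "partial_x (partial_y F) = partial_y (partial_x F)"
  by (intro fps_ext) (simp only: coef_partial_x coef_partial_y mult.left_commute)

lemma partial_var:
  "partial_x var_x = 1" "partial_y var_x = 0" "partial_x var_y = 0" "partial_y var_y = 1"
  by (auto simp: partial_x_def partial_y_def var_x_def var_y_def fps_eq_iff fps_X_def fps_nth_fps_const)

lemma sum_half_powers_le: "(\<Sum>k\<le>n. (1/2) ^ k :: real) \<le> 2"
  using geometric_sum[of "1/2::real" "Suc n"] by (simp add: lessThan_Suc_atMost)

text \<open>Comparing coefficients in \<open>F * G = 1\<close> bounds those of \<open>G\<close> by strong induction on the degree,
  as soon as \<open>N\<close> is so large that the non-constant part of \<open>F\<close> has weighted norm at most
  \<open>norm (coef F 0 0)\<close>.\<close>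

lemma convergent_series_inverse:
  assumes F: "convergent_series F" and F0: "coef F 0 0 \<noteq> 0"
  obtains G where "convergent_series G" "F * G = 1"
proof -
  \<comment> \<open>Formally, F is inverted as a series in x whose leading coefficient is a unit
    among the series in y; only the convergence of G remains to be shown.\<close>
  define G where "G = fps_right_inverse F (inverse (fps_nth F 0))"
  have FG: "F * G = 1"
    unfolding G_def by (rule fps_right_inverse) (use F0 in \<open>simp add: inverse_mult_eq_1'\<close>)
  obtain C M where CM: "C > 0" "M > 0" and le: "\<And>i j. norm (coef F i j) \<le> C * M ^ (i + j)"
    using convergent_seriesE[OF F] by blast
  define c where "c = norm (coef F 0 0)"
  have c: "c > 0" using F0 by (simp add: c_def)
  \<comment> \<open>The double sum of half powers is at most 4, so \<open>C * e * 4 \<le> c\<close>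
    is what closes the induction. The cap 1 allows \<open>e ^ (k + l)\<close> to be replaced by e
    whenever (k, l) is not (0, 0).\<close>
  define e where "e = min 1 (c / (4 * C))"
  have e: "e > 0" "e \<le> 1" "C * e * 4 \<le> c"
    using c CM by (auto simp: e_def min_def field_simps)
  define N where "N = 2 * M / e"
  have N: "N > 0" "M = N * (e / 2)" using CM e by (auto simp: N_def)
  have bound: "norm (coef G i j) \<le> 1 / c * N ^ (i + j)" for i j
  proof (induction "i + j" arbitrary: i j rule: less_induct)
    case less
    let ?S = "({..i} \<times> {..j}) - {(0, 0)}"
    let ?t = "\<lambda>(k, l). coef F k l * coef G (i - k) (j - l)"
    have "coef (F * G) i j = (\<Sum>p\<in>{..i} \<times> {..j}. ?t p)"
      by (simp add: coef_mult sum.cartesian_product)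
    also have "\<dots> = coef F 0 0 * coef G i j + (\<Sum>p\<in>?S. ?t p)"
      by (subst sum.remove[of _ "(0, 0)"]) auto
    finally have eq: "coef F 0 0 * coef G i j = coef 1 i j - (\<Sum>p\<in>?S. ?t p)"
      by (simp add: FG)
    have t_le: "norm (?t p) \<le> C * e / c * N ^ (i + j) * ((1/2) ^ fst p * (1/2) ^ snd p)"
      if "p \<in> ?S" for p
    proof -
      obtain k l where kl: "p = (k, l)" by (cases p)
      with that have p: "p = (k, l)" "k \<le> i" "l \<le> j" "(k, l) \<noteq> (0, 0)" by auto
      have "norm (coef G (i - k) (j - l)) \<le> 1 / c * N ^ (i - k + (j - l))"
        by (rule less) (use p in auto)
      then have "norm (?t p) \<le> (C * M ^ (k + l)) * (1 / c * N ^ (i - k + (j - l)))"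
        using CM by (simp add: p norm_mult del: times_divide_eq_left) (intro mult_mono le, auto)
      also have "\<dots> = C / c * N ^ ((k + l) + (i - k + (j - l))) * (e / 2) ^ (k + l)"
        by (simp add: N(2) power_mult_distrib power_add power_divide algebra_simps)
      also have "(k + l) + (i - k + (j - l)) = i + j" using p by simp
      also have "(e / 2) ^ (k + l) = e ^ (k + l) * ((1/2) ^ k * (1/2) ^ l)"
        by (simp add: power_divide power_add field_simps)
      also have "C / c * N ^ (i + j) * (e ^ (k + l) * ((1/2) ^ k * (1/2) ^ l))
          \<le> C / c * N ^ (i + j) * (e * ((1/2) ^ k * (1/2) ^ l))"
        using power_decreasing[of 1 "k + l" e] e p CM c N
        by (intro mult_left_mono mult_right_mono) auto
      finally show ?thesis by (simp add: p mult_ac)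
    qed
    have "norm (\<Sum>p\<in>?S. ?t p)
        \<le> (\<Sum>p\<in>?S. C * e / c * N ^ (i + j) * ((1/2) ^ fst p * (1/2) ^ snd p))"
      by (intro sum_norm_le t_le)
    show ?case
    proof (cases "i + j = 0")
      case True
      then show ?thesis using eq F0 by (simp add: c_def norm_divide[symmetric] field_simps) (metis norm_mult norm_one order_refl mult.commute)
    next
      case False
      have "c * norm (coef G i j) = norm (\<Sum>p\<in>?S. ?t p)"
        using arg_cong[OF eq, of norm] False by (auto simp: c_def norm_mult)
      also have "\<dots> \<le> (\<Sum>p\<in>?S. C * e / c * N ^ (i + j) * ((1/2) ^ fst p * (1/2) ^ snd p))"
        by fact
      also have "\<dots> \<le> (\<Sum>p\<in>{..i} \<times> {..j}. C * e / c * N ^ (i + j) * ((1/2) ^ fst p * (1/2) ^ snd p))"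
        using CM c e N by (intro sum_mono2) auto
      also have "\<dots> = C * e / c * N ^ (i + j) * ((\<Sum>k\<le>i. (1/2) ^ k) * (\<Sum>l\<le>j. (1/2) ^ l))"
        unfolding sum_distrib_left[symmetric]
        by (simp add: sum_product sum.cartesian_product case_prod_beta)
      also have "\<dots> \<le> C * e / c * N ^ (i + j) * (2 * 2)"
        using CM c e N
        by (intro mult_left_mono mult_mono sum_half_powers_le sum_nonneg) auto
      also have "\<dots> = (C * e * 4) * (N ^ (i + j) / c)" by simp
      also have "\<dots> \<le> c * (N ^ (i + j) / c)"
        using e N c by (intro mult_right_mono) auto
      finally show ?thesis using c by (simp add: field_simps)
    qed
  qed
  have "convergent_series G"
    by (rule convergent_seriesI[OF bound]) (use c N in auto)
  then show ?thesis using that FG by blast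
qed

section \<open>Division by the variables\<close>

lemma coef_var_x_power_mult:
  "coef (var_x ^ k * F) i j = (if i < k then 0 else coef F (i - k) j)"
  by (simp add: var_x_def fps_X_power_mult_nth)

lemma var_y_power: "var_y ^ k = fps_const (fps_X ^ k)"
  by (simp add: var_y_def fps_const_power)

lemma coef_var_y_power_mult:
  "coef (var_y ^ k * F) i j = (if j < k then 0 else coef F i (j - k))"
  by (simp add: var_y_power fps_X_power_mult_nth)

lemma divide_var_x_power:
  assumes "convergent_series F" "\<And>i j. i < k \<Longrightarrow> coef F i j = 0"
  obtains G where "convergent_series G" "F = var_x ^ k * G"
proof -
  obtain C M where CM: "C > 0" "M > 0" and le: "\<And>i j. norm (coef F i j) \<le> C * M ^ (i + j)"
    using convergent_seriesE[OF assms(1)] by blast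
  let ?G = "Abs_fps (\<lambda>i. fps_nth F (i + k))"
  have "convergent_series ?G"
  proof (rule convergent_seriesI)
    show "norm (coef ?G i j) \<le> (C * M ^ k) * M ^ (i + j)" for i j
      using le[of "i + k" j] by (simp add: power_add mult_ac)
  qed (use CM in auto)
  moreover have "F = var_x ^ k * ?G"
    by (intro fps_ext) (simp add: coef_var_x_power_mult assms(2))
  ultimately show ?thesis using that by blast
qed

lemma divide_var_y:
  assumes "convergent_series F" "\<And>i. coef F i 0 = 0"
  obtains G where "convergent_series G" "F = var_y * G"
proof -
  obtain C M where CM: "C > 0" "M > 0" and le: "\<And>i j. norm (coef F i j) \<le> C * M ^ (i + j)"
    using convergent_seriesE[OF assms(1)] by blast
  let ?G = "Abs_fps (\<lambda>i. Abs_fps (\<lambda>j. coef F i (j + 1)))"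
  have "convergent_series ?G"
  proof (rule convergent_seriesI)
    show "norm (coef ?G i j) \<le> (C * M) * M ^ (i + j)" for i j
      using le[of i "j + 1"] by (simp add: power_add mult_ac)
  qed (use CM in auto)
  moreover have "F = var_y * ?G"
    using coef_var_y_power_mult[of 1 ?G] by (intro fps_ext) (auto simp: assms(2))
  ultimately show ?thesis using that by blast
qed

lemma coef_0_mult: "coef (F * G) 0 0 = coef F 0 0 * coef G 0 0"
  by simp

text \<open>The terms free of x form a series in y without constant term, hence a multiple of y; the
  remaining terms are divisible by x.\<close>

lemma max_ideal_decomposition:
  assumes "convergent_series F" "coef F 0 0 = 0"
  obtains G H where "convergent_series G" "convergent_series H" "F = G * var_x + H * var_y"
proof -
  obtain C M where CM: "C > 0" "M > 0" and le: "\<And>i j. norm (coef F i j) \<le> C * M ^ (i + j)"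
    using convergent_seriesE[OF assms(1)] by blast
  let ?K = "fps_const (fps_nth F 0)"
  have K: "convergent_series ?K"
    by (rule convergent_seriesI[of _ C M]) (use CM le[of 0] in \<open>auto simp: fps_nth_fps_const\<close>)
  obtain H where H: "convergent_series H" "?K = var_y * H"
    by (rule divide_var_y[OF K]) (use assms(2) in \<open>auto simp: fps_nth_fps_const\<close>)
  obtain G where G: "convergent_series G" "F - ?K = var_x ^ 1 * G"
    by (rule divide_var_x_power[OF convergent_series_diff[OF assms(1) K], of 1]) auto
  have "F = G * var_x + H * var_y"
    using H(2) G(2) by (simp add: algebra_simps)
  then show ?thesis using that G(1) H(1) by blast
qed

section \<open>Dimensions of quotient spaces\<close>

text \<open>Padding the n equations with zero rows gives a square matrix, whose determinant vanishes
  because of row n.\<close>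

lemma homogeneous_system_nontrivial:
  fixes M :: "nat \<Rightarrow> nat \<Rightarrow> 'a :: field"
  assumes "n < N"
  obtains c where "\<exists>i<N. c i \<noteq> 0" "\<And>l. l < n \<Longrightarrow> (\<Sum>i<N. c i * M i l) = 0"
proof -
  define A where "A = mat N N (\<lambda>(l, i). if l < n then M i l else 0)"
  have A: "A \<in> carrier_mat N N" by (simp add: A_def)
  have "row A n = 0\<^sub>v N" using assms by (intro eq_vecI) (auto simp: A_def)
  then have "A = mat\<^sub>r N N (\<lambda>l. if l = n then 0\<^sub>v N else row A l)"
    using A by (intro eq_rowI) auto
  also have "det \<dots> = 0"
    by (rule det_row_0) (use assms A in auto)
  finally obtain v where v: "v \<in> carrier_vec N" "v \<noteq> 0\<^sub>v N" "A *\<^sub>v v = 0\<^sub>v N"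
    using det_0_iff_vec_prod_zero_field[OF A] by auto
  have "\<exists>i<N. v $ i \<noteq> 0"
  proof (rule ccontr)
    assume "\<not> (\<exists>i<N. v $ i \<noteq> 0)"
    then have "v = 0\<^sub>v N" using v(1) by (intro eq_vecI) auto
    then show False using v(2) by simp
  qed
  moreover have "(\<Sum>i<N. v $ i * M i l) = 0" if "l < n" for l
  proof -
    have "(A *\<^sub>v v) $ l = (\<Sum>i<N. v $ i * M i l)"
      using that assms v(1) by (auto simp: A_def scalar_prod_def lessThan_atLeast0 mult.commute intro!: sum.cong)
    then show ?thesis using v(3) that assms by simp
  qed
  ultimately show ?thesis using that by blast
qed

text \<open>Dimensions of quotients are recorded by chains of subspaces of the ambient space that
  grow by one line at a time. Quotients by different ideals can then be compared without moving
  between different quotient rings.\<close>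

locale quotient_dimension = vector_space scale
  for scale :: "'a::field \<Rightarrow> 'b::ab_group_add \<Rightarrow> 'b"
begin

definition line_sum :: "'b \<Rightarrow> 'b set \<Rightarrow> 'b set" where
  "line_sum v V = {scale c v + u | c u. u \<in> V}"

text \<open>\<open>reldim J V n\<close> says that the quotient space \<open>V / J\<close> has dimension \<open>n\<close>.\<close>

inductive reldim :: "'b set \<Rightarrow> 'b set \<Rightarrow> nat \<Rightarrow> bool" for J where
  zero: "reldim J J 0"
| line: "reldim J V n \<Longrightarrow> v \<notin> V \<Longrightarrow> reldim J (line_sum v V) (Suc n)"

lemma line_sumI: "u \<in> V \<Longrightarrow> scale c v + u \<in> line_sum v V"
  by (auto simp: line_sum_def)

lemma subset_line_sum: "V \<subseteq> line_sum v V"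
  using line_sumI[of _ V 0 v] by auto

lemma mem_line_sum: "subspace V \<Longrightarrow> v \<in> line_sum v V"
  using line_sumI[of 0 V 1 v] by (simp add: subspace_0)

lemma subspace_line_sum:
  assumes "subspace V"
  shows "subspace (line_sum v V)"
proof (rule subspaceI)
  show "0 \<in> line_sum v V" using assms subset_line_sum subspace_0 by blast
  show "x + y \<in> line_sum v V" if xy: "x \<in> line_sum v V" "y \<in> line_sum v V" for x y
  proof -
    obtain c u d w where "x = scale c v + u" "y = scale d v + w" "u \<in> V" "w \<in> V"
      using xy by (auto simp: line_sum_def)
    then show ?thesis
      using line_sumI[OF subspace_add[OF assms, of u w], of "c + d" v] by (simp add: algebra_simps)
  qed
  show "scale a x \<in> line_sum v V" if x: "x \<in> line_sum v V" for a x
  proof -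
    obtain c u where "x = scale c v + u" "u \<in> V"
      using x by (auto simp: line_sum_def)
    then show ?thesis
      using line_sumI[OF subspace_scale[OF assms, of u a], of "a * c" v]
      by (simp add: scale_right_distrib)
  qed
qed

lemma reldim_subspace: "reldim J V n \<Longrightarrow> subspace J \<Longrightarrow> subspace V"
  by (induction rule: reldim.induct) (auto intro: subspace_line_sum)

lemma reldim_mono: "reldim J V n \<Longrightarrow> J \<subseteq> V"
  by (induction rule: reldim.induct) (use subset_line_sum in auto)

lemma reldim_0: "reldim J V 0 \<Longrightarrow> V = J"
  by (erule reldim.cases) auto

lemma reldim_trans: "reldim I V b \<Longrightarrow> reldim J I a \<Longrightarrow> reldim J V (a + b)"
  by (induction rule: reldim.induct) (auto intro: reldim.line)

text \<open>Steinitz exchange: the coefficient of v in w cannot be 0, so v can be recovered from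
  w.\<close>

lemma line_sum_exchange:
  assumes "subspace V" "w \<in> line_sum v V" "w \<notin> V"
  shows "line_sum w V = line_sum v V"
proof -
  obtain c u where w: "w = scale c v + u" "u \<in> V" using assms(2) by (auto simp: line_sum_def)
  have c: "c \<noteq> 0" using w assms(3) by auto
  have v: "v = scale (1 / c) w + scale (- 1 / c) u"
    using c by (simp add: w(1) scale_right_distrib)
  have "v \<in> line_sum w V"
    by (subst v) (intro line_sumI subspace_scale assms(1) w(2))
  moreover have sub: "line_sum x V \<subseteq> line_sum y V" if "x \<in> line_sum y V" for x y
  proof
    fix z assume "z \<in> line_sum x V"
    then obtain d z' where "z = scale d x + z'" "z' \<in> V" by (auto simp: line_sum_def)
    then show "z \<in> line_sum y V"
      using that subspace_line_sum[OF assms(1), of y] subset_line_sum[of V y]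
      by (auto intro: subspace_add subspace_scale)
  qed
  ultimately show ?thesis using assms(2) by blast
qed

lemma line_sum_commute: "line_sum v (line_sum w V) = line_sum w (line_sum v V)"
proof -
  have "line_sum v (line_sum w V) \<subseteq> line_sum w (line_sum v V)" for v w
  proof
    fix x assume "x \<in> line_sum v (line_sum w V)"
    then obtain c d u where "x = scale c v + (scale d w + u)" "u \<in> V"
      unfolding line_sum_def by blast
    then have "x = scale d w + (scale c v + u)" "u \<in> V" by (simp_all add: add.left_commute)
    then show "x \<in> line_sum w (line_sum v V)" by (simp add: line_sumI)
  qed
  then show ?thesis by blast
qed

text \<open>The chain from A to V stays a chain after w is added to each of its members: if some v
  became redundant, exchange would put w into the next member, which lies in V.\<close>

lemma reldim_line_sum:
  assumes "reldim A V n" "subspace A" "w \<notin> V"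
  shows "reldim (line_sum w A) (line_sum w V) n"
  using assms
proof (induction rule: reldim.induct)
  case zero
  show ?case by (rule reldim.zero)
next
  case (line V n v)
  have V: "subspace V" using reldim_subspace line by blast
  have w: "w \<notin> V" using line.prems subset_line_sum by blast
  have "v \<notin> line_sum w V"
  proof
    assume "v \<in> line_sum w V"
    then have "line_sum v V = line_sum w V" using line_sum_exchange[OF V] line.hyps by blast
    then show False using mem_line_sum[OF V, of w] line.prems by blast
  qed
  then show ?case
    using reldim.line[OF line.IH[OF line.prems(1) w]] by (simp add: line_sum_commute)
qed

text \<open>A chain from J to V need not pass through I, so it is rearranged by induction. A step
  counts towards V / I if I already lies in the smaller space, and towards I / J otherwise, since
  its vector can then be exchanged for one of I.\<close>

lemma reldim_split:
  assumes "reldim J V n" "subspace J" "subspace I" "J \<subseteq> I" "I \<subseteq> V"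
  obtains a b where "a + b = n" "reldim J I a" "reldim I V b"
proof -
  have "\<exists>a b. a + b = n \<and> reldim J I a \<and> reldim I V b"
    using assms
  proof (induction arbitrary: I rule: reldim.induct)
    case zero
    then show ?case using reldim.zero[of J] by (intro exI[of _ 0]) auto
  next
    case (line V n v)
    have V: "subspace V" using reldim_subspace line by blast
    show ?case
    proof (cases "I \<subseteq> V")
      case True
      then obtain a b where "a + b = n" "reldim J I a" "reldim I V b"
        using line.IH[of I] line.prems by blast
      then show ?thesis
        using reldim.line[of I V b v] line.hyps by (intro exI[of _ a] exI[of _ "Suc b"]) auto
    next
      case False
      then obtain w where w: "w \<in> I" "w \<notin> V" by blast
      have Vw: "line_sum v V = line_sum w V"
        using line_sum_exchange[OF V _ w(2), of v] w(1) line.prems by blast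
      \<comment> \<open>Modular law: I contains w and lies in the sum of V and the line of
        w.\<close>
      have I: "I = line_sum w (I \<inter> V)"
      proof (intro equalityI subsetI)
        fix z assume z: "z \<in> I"
        then have "z \<in> line_sum w V" using line.prems Vw by blast
        then obtain d u where u: "z = scale d w + u" "u \<in> V" by (auto simp: line_sum_def)
        then have "u = z - scale d w" by simp
        then have "u \<in> I" using z w line.prems by (auto intro: subspace_diff subspace_scale)
        then show "z \<in> line_sum w (I \<inter> V)" using u by (auto intro: line_sumI)
      next
        fix z assume "z \<in> line_sum w (I \<inter> V)"
        then show "z \<in> I"
          using w line.prems by (auto simp: line_sum_def intro: subspace_add subspace_scale)
      qed
      have IV: "subspace (I \<inter> V)" using V line.prems by (intro subspace_inter)
      obtain a b where ab: "a + b = n" "reldim J (I \<inter> V) a" "reldim (I \<inter> V) V b"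
        using line.IH[of "I \<inter> V"] IV line.prems reldim_mono[OF line.hyps(1)] by blast
      have "reldim J I (Suc a)"
        using reldim.line[OF ab(2), of w] w I by auto
      moreover have "reldim I (line_sum v V) b"
        using reldim_line_sum[OF ab(3) IV w(2)] I Vw by simp
      ultimately show ?thesis using ab(1) by (intro exI[of _ "Suc a"] exI[of _ b]) auto
    qed
  qed
  then show ?thesis using that by blast
qed

lemma reldim_basis:
  assumes "reldim J V n" "subspace J"
  obtains b where "\<forall>l<n. b l \<in> V"
    "V = {j + (\<Sum>l<n. scale (c l) (b l)) | j c. j \<in> J}"
proof -
  have "\<exists>b. (\<forall>l<n. b l \<in> V) \<and> V = {j + (\<Sum>l<n. scale (c l) (b l)) | j c. j \<in> J}"
    using assms
  proof (induction rule: reldim.induct)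
    case zero
    show ?case by auto
  next
    case (line V n v)
    then obtain b where b: "\<forall>l<n. b l \<in> V" "V = {j + (\<Sum>l<n. scale (c l) (b l)) | j c. j \<in> J}"
      by blast
    define b' where "b' = b(n := v)"
    have V: "subspace V" using reldim_subspace line by blast
    have sum_b': "(\<Sum>l<Suc n. scale (c l) (b' l)) = scale (c n) v + (\<Sum>l<n. scale (c l) (b l))" for c
      by (simp add: b'_def)
    have "line_sum v V = {j + (\<Sum>l<Suc n. scale (c l) (b' l)) | j c. j \<in> J}"
    proof (intro equalityI subsetI)
      fix z assume "z \<in> line_sum v V"
      then obtain d u where u: "z = scale d v + u" "u \<in> V" by (auto simp: line_sum_def)
      then obtain j c where "u = j + (\<Sum>l<n. scale (c l) (b l))" "j \<in> J" using b(2) by blast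
      then show "z \<in> {j + (\<Sum>l<Suc n. scale (c l) (b' l)) | j c. j \<in> J}"
        unfolding sum_b' using u by (intro CollectI exI[of _ j] exI[of _ "c(n := d)"]) simp
    next
      fix z assume "z \<in> {j + (\<Sum>l<Suc n. scale (c l) (b' l)) | j c. j \<in> J}"
      then obtain j c where "z = scale (c n) v + (j + (\<Sum>l<n. scale (c l) (b l)))" "j \<in> J"
        unfolding sum_b' by (auto simp: add_ac)
      then show "z \<in> line_sum v V" using b(2) by (auto intro!: line_sumI)
    qed
    moreover have "\<forall>l<Suc n. b' l \<in> line_sum v V"
      using b(1) subset_line_sum[of V v] mem_line_sum[OF V, of v] by (auto simp: b'_def less_Suc_eq)
    ultimately show ?case by blast
  qed
  then show ?thesis using that by blast
qed

text \<open>Modulo J, the coordinates of the n + 1 vectors with respect to n spanning vectors give a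
  homogeneous system with fewer equations than unknowns.\<close>

lemma reldim_dependent:
  assumes "reldim J V n" "subspace J" "\<And>i. i \<le> n \<Longrightarrow> u i \<in> V"
  obtains c where "\<exists>i\<le>n. c i \<noteq> 0" "(\<Sum>i\<le>n. scale (c i) (u i)) \<in> J"
proof -
  obtain b where "\<forall>l<n. b l \<in> V"
    and b: "V = {j + (\<Sum>l<n. scale (c l) (b l)) | j c. j \<in> J}"
    by (rule reldim_basis[OF assms(1,2)])
  have "\<exists>p. i \<le> n \<longrightarrow> u i = fst p + (\<Sum>l<n. scale (snd p l) (b l)) \<and> fst p \<in> J" for i
  proof (cases "i \<le> n")
    case True
    then obtain j c where "u i = j + (\<Sum>l<n. scale (c l) (b l))" "j \<in> J"
      using assms(3)[OF True] b by blast
    then show ?thesis by (intro exI[of _ "(j, c)"]) simp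
  qed auto
  then have "\<forall>i. \<exists>p. i \<le> n \<longrightarrow> u i = fst p + (\<Sum>l<n. scale (snd p l) (b l)) \<and> fst p \<in> J" ..
  from choice[OF this] obtain p where
    p: "\<And>i. i \<le> n \<Longrightarrow> u i = fst (p i) + (\<Sum>l<n. scale (snd (p i) l) (b l)) \<and> fst (p i) \<in> J"
    by blast
  define j M where "j = fst \<circ> p" and "M = snd \<circ> p"
  have jM: "u i = j i + (\<Sum>l<n. scale (M i l) (b l))" "j i \<in> J" if "i \<le> n" for i
    using p[OF that] by (simp_all add: j_def M_def)
  obtain c where c: "\<exists>i<Suc n. c i \<noteq> 0" "\<And>l. l < n \<Longrightarrow> (\<Sum>i<Suc n. c i * M i l) = 0"
    using homogeneous_system_nontrivial[of n "Suc n" M] by blast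
  have "(\<Sum>i\<le>n. scale (c i) (u i))
      = (\<Sum>i\<le>n. scale (c i) (j i)) + (\<Sum>i\<le>n. \<Sum>l<n. scale (c i * M i l) (b l))"
    using jM by (simp add: scale_right_distrib scale_sum_right sum.distrib)
  also have "(\<Sum>i\<le>n. \<Sum>l<n. scale (c i * M i l) (b l)) = (\<Sum>l<n. scale (\<Sum>i\<le>n. c i * M i l) (b l))"
    by (subst sum.swap) (simp add: scale_sum_left)
  also have "\<dots> = 0"
    using c(2) by (intro sum.neutral) (simp add: lessThan_Suc_atMost)
  also have "(\<Sum>i\<le>n. scale (c i) (j i)) + 0 \<in> J"
    using jM assms(2) by (auto intro!: subspace_sum subspace_scale)
  finally show ?thesis using that c(1) by (auto simp: less_Suc_eq_le)
qed

text \<open>First isomorphism theorem for g modulo J. It is meant for multiplication by f, with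
  \<open>ann_ideal f\<close> as A and \<open>jacobian_ideal f\<close> as J. A vector outside V is
  sent outside g(V) + J because the kernel A lies in V. The space U confines the kernel condition to
  the ring, which is smaller than its type.\<close>

lemma reldim_image:
  assumes "reldim A V n" "subspace U" "A \<subseteq> U" "V \<subseteq> U" "subspace J"
    and add: "\<And>x y. g (x + y) = g x + g y" and scale: "\<And>c x. g (scale c x) = scale c (g x)"
    and A: "subspace A" and ker: "\<And>x. x \<in> U \<Longrightarrow> g x \<in> J \<longleftrightarrow> x \<in> A"
  shows "reldim J {g v + j | v j. v \<in> V \<and> j \<in> J} n"
  using assms(1,4)
proof (induction rule: reldim.induct)
  case zero
  have 0: "0 \<in> A" "g 0 = 0" using subspace_0[OF A] scale[of 0 0] by auto
  have "{g v + j | v j. v \<in> A \<and> j \<in> J} = J"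
  proof (intro equalityI subsetI)
    fix x assume "x \<in> {g v + j | v j. v \<in> A \<and> j \<in> J}"
    then obtain v j where "x = g v + j" "v \<in> A" "j \<in> J" by blast
    then show "x \<in> J" using ker \<open>A \<subseteq> U\<close> \<open>subspace J\<close> by (auto intro: subspace_add)
  next
    fix x assume "x \<in> J"
    then show "x \<in> {g v + j | v j. v \<in> A \<and> j \<in> J}"
      using 0 by (intro CollectI exI[of _ 0] exI[of _ x]) simp
  qed
  then show ?case using reldim.zero[of J] by simp
next
  case (line V n v)
  have V: "subspace V" using reldim_subspace line A by blast
  have VU: "V \<subseteq> U" and vU: "v \<in> U" using line.prems subset_line_sum mem_line_sum[OF V] by blast+
  have "g v \<notin> {g v + j | v j. v \<in> V \<and> j \<in> J}"
  proof
    assume "g v \<in> {g v + j | v j. v \<in> V \<and> j \<in> J}"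
    then obtain u j where uj: "g v = g u + j" "u \<in> V" "j \<in> J" by blast
    have "g v = g (v - u) + g u" by (simp flip: add)
    then have "g (v - u) \<in> J" using uj by simp
    moreover have "v - u \<in> U" using vU VU uj \<open>subspace U\<close> by (auto intro: subspace_diff)
    ultimately have "v - u \<in> V" using ker reldim_mono[OF line.hyps(1)] by blast
    then have "v - u + u \<in> V" using V uj(2) by (intro subspace_add)
    then show False using line.hyps by simp
  qed
  then have "reldim J (line_sum (g v) {g v + j | v j. v \<in> V \<and> j \<in> J}) (Suc n)"
    using line.IH[OF VU] by (intro reldim.line)
  also have "line_sum (g v) {g v + j | v j. v \<in> V \<and> j \<in> J} = {g w + j | w j. w \<in> line_sum v V \<and> j \<in> J}"
    unfolding line_sum_def
  proof (intro equalityI subsetI, goal_cases)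
    case (1 x)
    then obtain c u j where "x = scale c (g v) + (g u + j)" "u \<in> V" "j \<in> J" by blast
    then have "x = g (scale c v + u) + j" by (simp add: add scale add_ac)
    then show ?case using \<open>u \<in> V\<close> \<open>j \<in> J\<close> by blast
  next
    case (2 x)
    then obtain c u j where "x = g (scale c v + u) + j" "u \<in> V" "j \<in> J" by blast
    then have "x = scale c (g v) + (g u + j)" by (simp add: add scale add_ac)
    then show ?case using \<open>u \<in> V\<close> \<open>j \<in> J\<close> by blast
  qed
  finally show ?case .
qed

end

section \<open>Ideals and quotients of the ring of convergent power series\<close>

lemma carrier_conv_ring: "carrier conv_ring = {F. convergent_series F}"
  and conv_ring_simps [simp]: "mult conv_ring = (*)" "one conv_ring = 1" "zero conv_ring = 0"
    "add conv_ring = (+)"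
  by (simp_all add: conv_ring_def)

lemma mem_conv_ring [simp]: "F \<in> carrier conv_ring \<longleftrightarrow> convergent_series F"
  by (simp add: carrier_conv_ring)

lemma cring_conv_ring: "cring conv_ring"
proof (rule cringI)
  show "abelian_group conv_ring"
  proof (rule abelian_groupI)
    fix F assume "F \<in> carrier conv_ring"
    then show "\<exists>G\<in>carrier conv_ring. G \<oplus>\<^bsub>conv_ring\<^esub> F = \<zero>\<^bsub>conv_ring\<^esub>"
      by (intro bexI[of _ "- F"]) (auto intro: convergent_series_uminus)
  qed (auto intro: convergent_series_add convergent_series_0 simp: add_ac)
  show "Group.comm_monoid conv_ring"
    by (rule comm_monoidI) (auto intro: convergent_series_mult convergent_series_1 simp: mult_ac)
qed (auto simp: algebra_simps)

interpretation conv: cring conv_ring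
  by (rule cring_conv_ring)

lemma conv_ring_uminus: "convergent_series F \<Longrightarrow> \<ominus>\<^bsub>conv_ring\<^esub> F = - F"
  by (rule conv.minus_equality) (auto intro: convergent_series_uminus)

abbreviation cst :: "complex \<Rightarrow> complex fps fps" where
  "cst c \<equiv> fps_const (fps_const c)"

lemma ideal_conv_iff:
  "ideal I conv_ring \<longleftrightarrow> I \<subseteq> {F. convergent_series F} \<and> 0 \<in> I \<and> (\<forall>a\<in>I. \<forall>b\<in>I. a + b \<in> I) \<and>
     (\<forall>r a. convergent_series r \<longrightarrow> a \<in> I \<longrightarrow> r * a \<in> I)"  (is "_ \<longleftrightarrow> ?R")
proof
  assume "ideal I conv_ring"
  then interpret ideal I conv_ring .
  show ?R
    using a_subset zero_closed a_closed I_l_closed by (auto simp: carrier_conv_ring)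
next
  assume R: ?R
  show "ideal I conv_ring"
  proof (rule idealI[OF conv.ring_axioms])
    show "subgroup I (add_monoid conv_ring)"
    proof (rule conv.add.subgroupI)
      fix a assume a: "a \<in> I"
      then have "- 1 * a \<in> I" using R convergent_series_uminus[OF convergent_series_1] by blast
      then show "\<ominus>\<^bsub>conv_ring\<^esub> a \<in> I" using conv_ring_uminus a R by auto
    qed (use R in \<open>auto simp: carrier_conv_ring\<close>)
  qed (use R in \<open>auto, metis mult.commute\<close>)
qed

lemma ideal_convD:
  assumes "ideal I conv_ring"
  shows ideal_conv_convergent: "a \<in> I \<Longrightarrow> convergent_series a"
    and ideal_conv_0: "0 \<in> I"
    and ideal_conv_add: "a \<in> I \<Longrightarrow> b \<in> I \<Longrightarrow> a + b \<in> I"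
    and ideal_conv_mult: "convergent_series r \<Longrightarrow> a \<in> I \<Longrightarrow> r * a \<in> I"
    and ideal_conv_uminus: "a \<in> I \<Longrightarrow> - a \<in> I"
    and ideal_conv_diff: "a \<in> I \<Longrightarrow> b \<in> I \<Longrightarrow> a - b \<in> I"
proof -
  show *: "a \<in> I \<Longrightarrow> convergent_series a" "0 \<in> I" "a \<in> I \<Longrightarrow> b \<in> I \<Longrightarrow> a + b \<in> I"
    "convergent_series r \<Longrightarrow> a \<in> I \<Longrightarrow> r * a \<in> I" for a b r
    using assms unfolding ideal_conv_iff by auto
  show **: "a \<in> I \<Longrightarrow> - a \<in> I" for a
    using *(4)[of "- 1" a] convergent_series_uminus[OF convergent_series_1] by simp
  show "a \<in> I \<Longrightarrow> b \<in> I \<Longrightarrow> a - b \<in> I"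
    using *(3)[of a "- b"] **[of b] by simp
qed

lemma ideal_conv_sum: "ideal I conv_ring \<Longrightarrow> (\<And>i. i \<in> S \<Longrightarrow> a i \<in> I) \<Longrightarrow> sum a S \<in> I"
  by (induction S rule: infinite_finite_induct) (auto intro: ideal_conv_0 ideal_conv_add)

lemma ideal_conv_unit:
  assumes "ideal I conv_ring" "F \<in> I" "coef F 0 0 \<noteq> 0"
  shows "1 \<in> I"
proof -
  obtain G where "convergent_series G" "F * G = 1"
    using convergent_series_inverse ideal_conv_convergent assms by metis
  then show ?thesis using ideal_conv_mult[OF assms(1), of G F] assms(2) by (simp add: mult.commute)
qed

text \<open>The ambient vector space consists of all formal series; the ring enters as the subspace
  of the convergent ones.\<close>

interpretation cps: quotient_dimension "\<lambda>c F. cst c * F"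
  by unfold_locales (simp_all add: algebra_simps flip: fps_const_mult fps_const_add)

lemma ideal_subspace:
  assumes "ideal I conv_ring"
  shows "cps.subspace I"
  using ideal_conv_0[OF assms] ideal_conv_add[OF assms]
    ideal_conv_mult[OF assms convergent_series_const]
  by (intro cps.subspaceI) auto

lemma convergent_subspace: "cps.subspace {F. convergent_series F}"
  by (intro cps.subspaceI)
    (auto intro: convergent_series_0 convergent_series_add convergent_series_mult convergent_series_const)

section \<open>Chains of subspaces and dimensions of quotient rings\<close>

lemma coset_conv_ring: "J +>\<^bsub>conv_ring\<^esub> a = {j + a | j. j \<in> J}"
  by (auto simp: a_r_coset_def r_coset_def)

lemma coset_conv_ring_eq_iff:
  assumes "ideal J conv_ring"
  shows "J +>\<^bsub>conv_ring\<^esub> a = J +>\<^bsub>conv_ring\<^esub> b \<longleftrightarrow> a - b \<in> J"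
proof
  assume "J +>\<^bsub>conv_ring\<^esub> a = J +>\<^bsub>conv_ring\<^esub> b"
  then have "0 + a \<in> {j + b | j. j \<in> J}"
    using ideal_conv_0[OF assms] unfolding coset_conv_ring by blast
  then show "a - b \<in> J" by auto
next
  have *: "{j + a | j. j \<in> J} \<subseteq> {j + b | j. j \<in> J}" if "a - b \<in> J" for a b
  proof clarify
    fix j assume "j \<in> J"
    then have "j + (a - b) \<in> J" using that assms by (intro ideal_conv_add)
    then show "\<exists>j'. j + a = j' + b \<and> j' \<in> J" by (intro exI[of _ "j + (a - b)"]) simp
  qed
  assume ab: "a - b \<in> J"
  then have "b - a \<in> J" using ideal_conv_uminus[OF assms, of "a - b"] by simp
  then show "J +>\<^bsub>conv_ring\<^esub> a = J +>\<^bsub>conv_ring\<^esub> b"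
    unfolding coset_conv_ring using *[of a b] *[of b a] ab by blast
qed

text \<open>When 1 is not in J, the projection carries this subfield to
  \<open>quot_scalars J\<close>, and over a subfield the dimension is a well-defined number.\<close>

lemma subfield_constants: "subfield (range cst) conv_ring"
proof (rule conv.subfieldI)
  show "subcring (range cst) conv_ring"
  proof (rule conv.subcringI)
    show "subring (range cst) conv_ring"
    proof (rule conv.subringI)
      show "\<ominus>\<^bsub>conv_ring\<^esub> h \<in> range cst" if "h \<in> range cst" for h
      proof -
        obtain c where "h = cst c" using \<open>h \<in> range cst\<close> by blast
        then have "\<ominus>\<^bsub>conv_ring\<^esub> h = cst (- c)"
          using conv_ring_uminus[OF convergent_series_const[of c]] by simp
        then show ?thesis by blast
      qed
      show "\<one>\<^bsub>conv_ring\<^esub> \<in> range cst" by (auto intro!: image_eqI[of _ _ 1])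
      show "h1 \<otimes>\<^bsub>conv_ring\<^esub> h2 \<in> range cst" "h1 \<oplus>\<^bsub>conv_ring\<^esub> h2 \<in> range cst"
        if "h1 \<in> range cst" "h2 \<in> range cst" for h1 h2
      proof -
        obtain c d where "h1 = cst c" "h2 = cst d" using \<open>h1 \<in> range cst\<close> \<open>h2 \<in> range cst\<close> by blast
        then have "h1 \<otimes>\<^bsub>conv_ring\<^esub> h2 = cst (c * d)" "h1 \<oplus>\<^bsub>conv_ring\<^esub> h2 = cst (c + d)"
          by simp_all
        then show "h1 \<otimes>\<^bsub>conv_ring\<^esub> h2 \<in> range cst" "h1 \<oplus>\<^bsub>conv_ring\<^esub> h2 \<in> range cst"
          by blast+
      qed
    qed (auto intro: convergent_series_const)
  qed (auto simp: mult.commute)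
  show "Units (conv_ring\<lparr>carrier := range cst\<rparr>) = range cst - {\<zero>\<^bsub>conv_ring\<^esub>}"
  proof (intro equalityI subsetI)
    fix u assume "u \<in> Units (conv_ring\<lparr>carrier := range cst\<rparr>)"
    then obtain v where "u \<in> range cst" "v * u = 1" by (auto simp: Units_def)
    then show "u \<in> range cst - {\<zero>\<^bsub>conv_ring\<^esub>}" by auto
  next
    fix u assume "u \<in> range cst - {\<zero>\<^bsub>conv_ring\<^esub>}"
    then obtain c where u: "u = cst c" "c \<noteq> 0" by auto
    then have "cst (1 / c) * u = 1" "u * cst (1 / c) = 1"
      by (simp_all add: u(1))
    then show "u \<in> Units (conv_ring\<lparr>carrier := range cst\<rparr>)"
      using u by (auto simp: Units_def intro!: exI[of _ "1 / c"])
  qed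
qed

lemma quot_conv_ring_add:
  assumes "ideal J conv_ring" "convergent_series a" "convergent_series b"
  shows "(J +>\<^bsub>conv_ring\<^esub> a) \<oplus>\<^bsub>conv_ring Quot J\<^esub> (J +>\<^bsub>conv_ring\<^esub> b) = J +>\<^bsub>conv_ring\<^esub> (a + b)"
  using ring_hom_add[OF ideal.rcos_ring_hom[OF assms(1)], of a b] assms by simp

lemma quot_conv_ring_mult:
  assumes "ideal J conv_ring" "convergent_series a" "convergent_series b"
  shows "(J +>\<^bsub>conv_ring\<^esub> a) \<otimes>\<^bsub>conv_ring Quot J\<^esub> (J +>\<^bsub>conv_ring\<^esub> b) = J +>\<^bsub>conv_ring\<^esub> (a * b)"
  using ring_hom_mult[OF ideal.rcos_ring_hom[OF assms(1)], of a b] assms by simp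

lemma carrier_quot_conv_ring:
  "carrier (conv_ring Quot J) = (\<lambda>a. J +>\<^bsub>conv_ring\<^esub> a) ` {F. convergent_series F}"
  by (auto simp: FactRing_def A_RCOSETS_def' carrier_conv_ring)

lemma zero_quot_conv_ring: "\<zero>\<^bsub>conv_ring Quot J\<^esub> = J"
  by (simp add: FactRing_def)

lemma coset_conv_ring_0: "J +>\<^bsub>conv_ring\<^esub> 0 = J"
  by (simp add: coset_conv_ring)

lemma quot_line_extension:
  assumes J: "ideal J conv_ring" and v: "convergent_series v" and V: "V \<subseteq> {F. convergent_series F}"
  shows "ring.line_extension (conv_ring Quot J) (quot_scalars J) (J +>\<^bsub>conv_ring\<^esub> v)
           ((\<lambda>a. J +>\<^bsub>conv_ring\<^esub> a) ` V)
         = (\<lambda>a. J +>\<^bsub>conv_ring\<^esub> a) ` cps.line_sum v V"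
proof -
  interpret Q: ring "conv_ring Quot J" by (rule ideal.quotient_is_ring[OF J])
  have eq: "(J +>\<^bsub>conv_ring\<^esub> cst c) \<otimes>\<^bsub>conv_ring Quot J\<^esub> (J +>\<^bsub>conv_ring\<^esub> v)
      \<oplus>\<^bsub>conv_ring Quot J\<^esub> (J +>\<^bsub>conv_ring\<^esub> u) = J +>\<^bsub>conv_ring\<^esub> (cst c * v + u)" if "u \<in> V" for c u
  proof -
    have "convergent_series u" "convergent_series (cst c * v)"
      using that V v by (auto intro: convergent_series_mult convergent_series_const)
    then show ?thesis
      by (subst quot_conv_ring_mult[OF J convergent_series_const v]) (rule quot_conv_ring_add[OF J])
  qed
  show ?thesis
  proof (intro equalityI subsetI)
    fix x assume "x \<in> Q.line_extension (quot_scalars J) (J +>\<^bsub>conv_ring\<^esub> v) ((\<lambda>a. J +>\<^bsub>conv_ring\<^esub> a) ` V)"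
    then obtain c u where "u \<in> V" "x = J +>\<^bsub>conv_ring\<^esub> (cst c * v + u)"
      unfolding Q.line_extension_mem_iff quot_scalars_def using eq by auto
    then show "x \<in> (\<lambda>a. J +>\<^bsub>conv_ring\<^esub> a) ` cps.line_sum v V"
      by (auto intro: cps.line_sumI)
  next
    fix x assume "x \<in> (\<lambda>a. J +>\<^bsub>conv_ring\<^esub> a) ` cps.line_sum v V"
    then obtain c u where "u \<in> V" "x = J +>\<^bsub>conv_ring\<^esub> (cst c * v + u)"
      by (auto simp: cps.line_sum_def)
    then show "x \<in> Q.line_extension (quot_scalars J) (J +>\<^bsub>conv_ring\<^esub> v) ((\<lambda>a. J +>\<^bsub>conv_ring\<^esub> a) ` V)"
      unfolding Q.line_extension_mem_iff quot_scalars_def using eq by auto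
  qed
qed

lemma reldim_imp_dimension:
  assumes J: "ideal J conv_ring" and "cps.reldim J V n" "V \<subseteq> {F. convergent_series F}"
  shows "ring.dimension (conv_ring Quot J) n (quot_scalars J) ((\<lambda>a. J +>\<^bsub>conv_ring\<^esub> a) ` V)"
  using assms(2,3)
proof (induction rule: cps.reldim.induct)
  interpret Q: ring "conv_ring Quot J" by (rule ideal.quotient_is_ring[OF J])
  case zero
  have "J +>\<^bsub>conv_ring\<^esub> a = J" if "a \<in> J" for a
    using coset_conv_ring_eq_iff[OF J, of a 0] that by (simp add: coset_conv_ring_0)
  then have "(\<lambda>a. J +>\<^bsub>conv_ring\<^esub> a) ` J = {J}" using ideal_conv_0[OF J] by auto
  then show ?case
    using Q.zero_dim[of "quot_scalars J"] by (simp add: zero_quot_conv_ring)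
next
  interpret Q: ring "conv_ring Quot J" by (rule ideal.quotient_is_ring[OF J])
  case (line V n v)
  have V: "cps.subspace V" using cps.reldim_subspace line ideal_subspace[OF J] by blast
  have VC: "V \<subseteq> {F. convergent_series F}" and v: "convergent_series v"
    using line.prems cps.subset_line_sum cps.mem_line_sum[OF V] by blast+
  have "J +>\<^bsub>conv_ring\<^esub> v \<notin> (\<lambda>a. J +>\<^bsub>conv_ring\<^esub> a) ` V"
  proof
    assume "J +>\<^bsub>conv_ring\<^esub> v \<in> (\<lambda>a. J +>\<^bsub>conv_ring\<^esub> a) ` V"
    then obtain u where "u \<in> V" "v - u \<in> J" using coset_conv_ring_eq_iff[OF J] by auto
    then have "v - u + u \<in> V" using V cps.reldim_mono[OF line.hyps(1)] by (intro cps.subspace_add) auto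
    then show False using line.hyps by simp
  qed
  moreover have "J +>\<^bsub>conv_ring\<^esub> v \<in> carrier (conv_ring Quot J)"
    using v by (auto simp: carrier_quot_conv_ring)
  ultimately show ?case
    unfolding quot_line_extension[OF J v VC, symmetric]
    by (intro Q.Suc_dim line.IH VC)
qed

text \<open>Each coset that extends the chain in the quotient is lifted to a representative. As the
  lifted chain starts at J, its members are full preimages.\<close>

lemma dimension_imp_reldim:
  assumes J: "ideal J conv_ring" and "ring.dimension (conv_ring Quot J) n (quot_scalars J) E"
  shows "\<exists>V \<subseteq> {F. convergent_series F}. E = (\<lambda>a. J +>\<^bsub>conv_ring\<^esub> a) ` V \<and> cps.reldim J V n"
proof -
  interpret Q: ring "conv_ring Quot J" by (rule ideal.quotient_is_ring[OF J])
  show ?thesis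
    using assms(2)
  proof (induction n "quot_scalars J" E rule: Q.dimension.induct)
    case zero_dim
    have "J +>\<^bsub>conv_ring\<^esub> a = J" if "a \<in> J" for a
      using coset_conv_ring_eq_iff[OF J, of a 0] that by (simp add: coset_conv_ring_0)
    then have "(\<lambda>a. J +>\<^bsub>conv_ring\<^esub> a) ` J = {J}" using ideal_conv_0[OF J] by auto
    then show ?case
      using cps.reldim.zero[of J] ideal_conv_convergent[OF J] by (intro exI[of _ J]) (auto simp: zero_quot_conv_ring)
  next
    case (Suc_dim x E n)
    then obtain V where V: "V \<subseteq> {F. convergent_series F}" "E = (\<lambda>a. J +>\<^bsub>conv_ring\<^esub> a) ` V" "cps.reldim J V n"
      by blast
    obtain v where v: "convergent_series v" "x = J +>\<^bsub>conv_ring\<^esub> v"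
      using Suc_dim by (auto simp: carrier_quot_conv_ring)
    have "v \<notin> V" using Suc_dim V v by auto
    then have "cps.reldim J (cps.line_sum v V) (Suc n)" using V by (intro cps.reldim.line)
    moreover have "cps.line_sum v V \<subseteq> {F. convergent_series F}"
      using V v by (auto simp: cps.line_sum_def intro!: convergent_series_add convergent_series_mult convergent_series_const)
    ultimately show ?case
      using quot_line_extension[OF J v(1) V(1)] V v by blast
  qed
qed

lemma finite_quot_dimD:
  assumes J: "ideal J conv_ring" and "finite_quot_dim J"
  obtains n where "cps.reldim J {F. convergent_series F} n"
proof -
  interpret Q: ring "conv_ring Quot J" by (rule ideal.quotient_is_ring[OF J])
  obtain n where "Q.dimension n (quot_scalars J) (carrier (conv_ring Quot J))"
    using assms(2) by (auto simp: finite_quot_dim_def Q.finite_dimension_def)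
  from dimension_imp_reldim[OF J this] obtain V where V: "V \<subseteq> {F. convergent_series F}"
    "carrier (conv_ring Quot J) = (\<lambda>a. J +>\<^bsub>conv_ring\<^esub> a) ` V" "cps.reldim J V n"
    by (elim exE conjE)
  \<comment> \<open>V is a subspace containing J, so its image in the quotient determines
    it.\<close>
  have "F \<in> V" if "convergent_series F" for F
  proof -
    have "J +>\<^bsub>conv_ring\<^esub> F \<in> (\<lambda>a. J +>\<^bsub>conv_ring\<^esub> a) ` V"
      using that by (simp add: carrier_quot_conv_ring flip: V(2))
    then obtain u where u: "u \<in> V" "F - u \<in> J" using coset_conv_ring_eq_iff[OF J] by auto
    have "F - u + u \<in> V"
      using u cps.reldim_mono[OF V(3)] cps.reldim_subspace[OF V(3) ideal_subspace[OF J]]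
      by (intro cps.subspace_add) auto
    then show ?thesis by simp
  qed
  then have "V = {F. convergent_series F}" using V(1) by blast
  then show ?thesis using V(3) that by blast
qed

lemma reldim_imp_quot_dim:
  assumes J: "ideal J conv_ring" "1 \<notin> J" and n: "cps.reldim J {F. convergent_series F} n"
  shows "finite_quot_dim J" "quot_dim J = n"
proof -
  interpret Q: ring "conv_ring Quot J" by (rule ideal.quotient_is_ring[OF J(1)])
  interpret h: ring_hom_ring conv_ring "conv_ring Quot J" "\<lambda>a. J +>\<^bsub>conv_ring\<^esub> a"
    by (rule ideal.rcos_ring_hom_ring[OF J(1)])
  have ne: "\<one>\<^bsub>conv_ring Quot J\<^esub> \<noteq> \<zero>\<^bsub>conv_ring Quot J\<^esub>"
  proof
    assume "\<one>\<^bsub>conv_ring Quot J\<^esub> = \<zero>\<^bsub>conv_ring Quot J\<^esub>"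
    then have "J +>\<^bsub>conv_ring\<^esub> 1 = J +>\<^bsub>conv_ring\<^esub> 0" by (simp add: FactRing_def coset_conv_ring_0)
    then show False using coset_conv_ring_eq_iff[OF J(1), of 1 0] J(2) by simp
  qed
  have "subfield ((\<lambda>a. J +>\<^bsub>conv_ring\<^esub> a) ` range cst) (conv_ring Quot J)"
    by (rule h.img_is_subfield(2)[OF subfield_constants ne])
  then have sf: "subfield (quot_scalars J) (conv_ring Quot J)"
    by (simp add: quot_scalars_def image_image)
  have dim: "Q.dimension n (quot_scalars J) (carrier (conv_ring Quot J))"
    using reldim_imp_dimension[OF J(1) n] by (simp add: carrier_quot_conv_ring)
  show "finite_quot_dim J"
    unfolding finite_quot_dim_def Q.finite_dimension_def using dim by blast
  show "quot_dim J = n"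
    using Q.dimI[OF sf dim] by (simp add: quot_dim_def over_def)
qed

section \<open>Minors and Fitting's lemma\<close>

text \<open>The vectors \<open>v j\<close> are the columns and r selects rows, in any order and with
  repetitions. This leaves room for column operations; the increasing index maps of
  \<open>minors\<close> are brought in later by sorting.\<close>

definition minor :: "nat \<Rightarrow> (nat \<Rightarrow> nat) \<Rightarrow> (nat \<Rightarrow> nat \<Rightarrow> 'a) \<Rightarrow> 'a :: comm_ring_1" where
  "minor k r v = det (mat k k (\<lambda>(i, j). v j (r i)))"

text \<open>Enumerates in increasing order the indices other than i, as after the deletion of a row
  or column.\<close>

definition skip :: "nat \<Rightarrow> nat \<Rightarrow> nat" where
  "skip i l = (if l < i then l else Suc l)"

lemma skip_neq: "skip i l \<noteq> i"
  by (simp add: skip_def)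

lemma skip_less: "l < k \<Longrightarrow> skip i l < Suc k"
  by (simp add: skip_def)

lemma minor_cong:
  "(\<And>i j. i < k \<Longrightarrow> j < k \<Longrightarrow> v j (r i) = w j (s i)) \<Longrightarrow> minor k r v = minor k s w"
  unfolding minor_def by (intro arg_cong[of _ _ det] eq_matI) auto

lemma minor_0: "minor 0 r v = 1"
  unfolding minor_def by (rule det_dim_zero) simp

text \<open>Laplace expansion along column j. With that column written as an update, the cofactors
  visibly do not depend on a, so linearity in a can be read off.\<close>

lemma minor_expand:
  assumes "j < Suc k"
  shows "minor (Suc k) r (v(j := a))
    = (\<Sum>i<Suc k. a (r i) * ((- 1) ^ (i + j) * minor k (\<lambda>l. r (skip i l)) (\<lambda>l. v (skip j l))))"
proof -
  let ?A = "mat (Suc k) (Suc k) (\<lambda>(i, l). (v(j := a)) l (r i))"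
  have "det ?A = (\<Sum>i<Suc k. ?A $$ (i, j) * cofactor ?A i j)"
    by (rule laplace_expansion_column) (use assms in auto)
  moreover have "cofactor ?A i j
      = (- 1) ^ (i + j) * minor k (\<lambda>l. r (skip i l)) (\<lambda>l. v (skip j l))" if "i < Suc k" for i
  proof -
    have "mat_delete ?A i j = mat k k (\<lambda>(i', j'). v (skip j j') (r (skip i i')))"
      unfolding mat_delete_def by (rule eq_matI) (auto simp: skip_def)
    then show ?thesis by (simp add: cofactor_def minor_def)
  qed
  ultimately show ?thesis
    unfolding minor_def using assms by (auto intro!: sum.cong)
qed

lemma minor_linear:
  assumes "j < k" "\<And>i. i < k \<Longrightarrow> a (r i) = (\<Sum>c\<in>C. w c * b c (r i))"
  shows "minor k r (v(j := a)) = (\<Sum>c\<in>C. w c * minor k r (v(j := b c)))"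
proof -
  obtain k' where k: "k = Suc k'" using assms(1) by (cases k) auto
  show ?thesis
    unfolding k minor_expand[OF assms(1)[unfolded k]]
    using assms(2) unfolding k
    by (simp add: sum_distrib_right sum_distrib_left mult.assoc del: sum.lessThan_Suc) (rule sum.swap)
qed

lemma minor_add:
  assumes "j < k"
  shows "minor k r (v(j := \<lambda>i. a i + s * b i)) = minor k r (v(j := a)) + s * minor k r (v(j := b))"
  using minor_linear[OF assms, where C = "{False, True}" and w = "\<lambda>c. if c then s else 1"
      and b = "\<lambda>c. if c then b else a"]
  by simp

lemma minor_identical:
  assumes "i < k" "j < k" "i \<noteq> j" "v i = v j"
  shows "minor k r v = 0"
  unfolding minor_def
  by (rule det_identical_columns[of _ k i j]) (use assms in \<open>auto intro!: eq_vecI\<close>)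

lemma minor_zero_row:
  assumes "i < k" "\<And>j. j < k \<Longrightarrow> v j (r i) = 0"
  shows "minor k r v = 0"
  unfolding minor_def
  by (subst laplace_expansion_row[of _ k i]) (use assms in auto)

text \<open>I contains the determinantal ideal of the possibly infinite matrix with N rows whose
  columns are the vectors in S.\<close>

definition minors_in :: "complex fps fps set \<Rightarrow> nat \<Rightarrow> (nat \<Rightarrow> complex fps fps) set \<Rightarrow> nat \<Rightarrow> bool" where
  "minors_in I N S k \<longleftrightarrow>
     (\<forall>r v. (\<forall>i<k. r i < N) \<longrightarrow> (\<forall>j<k. v j \<in> S) \<longrightarrow> minor k r v \<in> I)"

lemma minors_inD:
  "minors_in I N S k \<Longrightarrow> (\<And>i. i < k \<Longrightarrow> r i < N) \<Longrightarrow> (\<And>j. j < k \<Longrightarrow> v j \<in> S) \<Longrightarrow> minor k r v \<in> I"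
  by (auto simp: minors_in_def)

lemma minors_in_mono: "minors_in I N S k \<Longrightarrow> T \<subseteq> S \<Longrightarrow> minors_in I N T k"
  unfolding minors_in_def by blast

lemma convergent_series_sign: "convergent_series ((- 1) ^ n)"
  by (intro convergent_series_power convergent_series_uminus convergent_series_1)

text \<open>By multilinearity, the columns are replaced one at a time by the vectors that span them;
  t counts the columns still to be replaced.\<close>

lemma minors_in_span:
  assumes I: "ideal I conv_ring" and T: "minors_in I N (A ` {..<m}) k"
    and S: "\<And>v. v \<in> S \<Longrightarrow> 
      \<exists>w. (\<forall>c<m. convergent_series (w c)) \<and> (\<forall>i<N. v i = (\<Sum>c<m. w c * A c i))"
  shows "minors_in I N S k"
  unfolding minors_in_def
proof (intro allI impI)
  fix r v assume r: "\<forall>i<k. r i < N" and v: "\<forall>j<k. v j \<in> S"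
  have "minor k r u \<in> I" if "t \<le> k" "\<forall>j<t. u j \<in> S" "\<forall>j. t \<le> j \<and> j < k \<longrightarrow> u j \<in> A ` {..<m}" for t u
    using that
  proof (induction t arbitrary: u)
    case 0
    then show ?case by (intro minors_inD[OF T]) (use r in auto)
  next
    case (Suc t)
    obtain w where w: "\<forall>c<m. convergent_series (w c)" "\<forall>i<N. u t i = (\<Sum>c<m. w c * A c i)"
      using S Suc.prems by blast
    have "minor k r (u(t := u t)) = (\<Sum>c<m. w c * minor k r (u(t := A c)))"
      by (rule minor_linear) (use Suc.prems r w in auto)
    also have "\<dots> \<in> I"
    proof (intro ideal_conv_sum[OF I] ideal_conv_mult[OF I])
      fix c assume "c \<in> {..<m}"
      then show "convergent_series (w c)" using w by blast
      show "minor k r (u(t := A c)) \<in> I"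
        using Suc.prems \<open>c \<in> {..<m}\<close> by (intro Suc.IH) auto
    qed
    finally show ?case by simp
  qed
  from this[of k v] show "minor k r v \<in> I" using v by (metis leD order_refl)
qed

text \<open>Expansion along the exceptional column j0 leaves k-minors whose columns all come from
  S.\<close>

lemma minor_laplace_in:
  assumes I: "ideal I conv_ring" and S: "minors_in I N S k"
    and r: "\<forall>i<Suc k. r i < N" and v: "\<forall>j<Suc k. j \<noteq> j0 \<longrightarrow> v j \<in> S"
    and p: "\<And>i. i < N \<Longrightarrow> convergent_series (v j0 i)" and "j0 < Suc k"
  shows "minor (Suc k) r v \<in> I"
proof -
  have "minor (Suc k) r (v(j0 := v j0)) \<in> I"
    unfolding minor_expand[OF \<open>j0 < Suc k\<close>]
  proof (intro ideal_conv_sum[OF I] ideal_conv_mult[OF I])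
    fix i assume i: "i \<in> {..<Suc k}"
    show "convergent_series (v j0 (r i))" using p r i by auto
    show "convergent_series ((- 1) ^ (i + j0))" by (rule convergent_series_sign)
    show "minor k (\<lambda>l. r (skip i l)) (\<lambda>l. v (skip j0 l)) \<in> I"
      by (rule minors_inD[OF S]) (use r v skip_less skip_neq in auto)
  qed
  then show ?thesis by simp
qed

text \<open>Expanding a minor of the vectors \<open>v + s * p\<close> by columns, all terms in which \<open>p\<close> occurs
  twice vanish, and the others are combinations of \<open>k\<close>-minors of the vectors \<open>v\<close>.\<close>

lemma minors_in_add_vector:
  assumes I: "ideal I conv_ring" and S: "minors_in I N S k"
    and conv: "\<And>v i. v \<in> S \<Longrightarrow> i < N \<Longrightarrow> convergent_series (v i)"
    and p: "\<And>i. i < N \<Longrightarrow> convergent_series (p i)"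
  shows "minors_in I N {\<lambda>i. v i + s * p i | v s. v \<in> S \<and> convergent_series s} (Suc k)"
  unfolding minors_in_def
proof (intro allI impI)
  fix r u assume r: "\<forall>i<Suc k. r i < N"
    and u: "\<forall>j<Suc k. u j \<in> {\<lambda>i. v i + s * p i | v s. v \<in> S \<and> convergent_series s}"
  have "\<forall>j. \<exists>q. j < Suc k \<longrightarrow> fst q \<in> S \<and> convergent_series (snd q) \<and> u j = (\<lambda>i. fst q i + snd q * p i)"
    using u by fastforce
  from choice[OF this] obtain q where q: "\<And>j. j < Suc k \<Longrightarrow>
      fst (q j) \<in> S \<and> convergent_series (snd (q j)) \<and> u j = (\<lambda>i. fst (q j) i + snd (q j) * p i)"
    by blast
  define v s where "v = (\<lambda>j. fst (q j))" and "s = (\<lambda>j. snd (q j))"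
  have v: "v j \<in> S" and s: "convergent_series (s j)" and uj: "u j = (\<lambda>i. v j i + s j * p i)"
    if "j < Suc k" for j
    using q[OF that] by (simp_all add: v_def s_def)
  \<comment> \<open>Interpolates between the columns v and the columns u, changing one column at a
    time.\<close>
  define w where "w = (\<lambda>t j. if j < t then (\<lambda>i. v j i + s j * p i) else v j)"
  have w_Suc: "w (Suc t) = (w t)(t := \<lambda>i. v t i + s t * p i)"
    and w_self: "(w t)(t := v t) = w t" for t
    by (auto simp: w_def fun_eq_iff)
  \<comment> \<open>Once p is itself a column, adding multiples of p to the other columns does not
    change the minor.\<close>
  have one: "minor (Suc k) r ((w t)(j0 := p)) \<in> I" if "t \<le> Suc k" "j0 < Suc k" for t j0
    using that
  proof (induction t)
    case 0
    show ?case
      by (rule minor_laplace_in[OF I S r, of j0]) (use 0 p v in \<open>auto simp: w_def\<close>)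
  next
    case (Suc t)
    show ?case
    proof (cases "t = j0")
      case True
      then have "(w (Suc t))(j0 := p) = (w t)(j0 := p)" by (simp add: w_Suc)
      then show ?thesis using Suc by simp
    next
      case False
      then have eq: "(w (Suc t))(j0 := p) = ((w t)(j0 := p))(t := \<lambda>i. v t i + s t * p i)"
        by (simp add: w_Suc fun_upd_twist)
      have "((w t)(j0 := p))(t := v t) = (w t)(j0 := p)"
        using False by (subst fun_upd_twist) (simp_all add: w_self)
      moreover have "minor (Suc k) r (((w t)(j0 := p))(t := p)) = 0"
        by (rule minor_identical[of j0 _ t]) (use False Suc.prems in auto)
      ultimately have drop: "minor (Suc k) r ((w (Suc t))(j0 := p)) = minor (Suc k) r ((w t)(j0 := p))"
        unfolding eq using Suc.prems minor_add[of t "Suc k" r "(w t)(j0 := p)" "v t" "s t" p] by simp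
      show ?thesis unfolding drop by (rule Suc.IH) (use Suc.prems in auto)
    qed
  qed
  have "minor (Suc k) r (w t) \<in> I" if "t \<le> Suc k" for t
    using that
  proof (induction t)
    case 0
    show ?case
      by (rule minor_laplace_in[OF I S r, of 0]) (use v conv in \<open>auto simp: w_def\<close>)
  next
    case (Suc t)
    have "minor (Suc k) r (w (Suc t)) = minor (Suc k) r (w t) + s t * minor (Suc k) r ((w t)(t := p))"
      unfolding w_Suc using minor_add[of t "Suc k" r "w t" "v t" "s t" p] Suc.prems by (simp add: w_self)
    also have "\<dots> \<in> I"
      using Suc s one by (intro ideal_conv_add[OF I] ideal_conv_mult[OF I]) auto
    finally show ?case .
  qed
  from this[of "Suc k"] have "minor (Suc k) r (w (Suc k)) \<in> I" by simp
  moreover have "minor (Suc k) r (w (Suc k)) = minor (Suc k) r u"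
    by (rule minor_cong) (simp add: w_def uj)
  ultimately show "minor (Suc k) r u \<in> I" by simp
qed

lemma minors_in_add_vectors:
  assumes I: "ideal I conv_ring" and S: "minors_in I N S k"
    and conv: "\<And>v i. v \<in> S \<Longrightarrow> i < N \<Longrightarrow> convergent_series (v i)"
    and p: "\<And>l i. l < d \<Longrightarrow> i < N \<Longrightarrow> convergent_series (p l i)"
  shows "minors_in I N {\<lambda>i. v i + (\<Sum>l<d. s l * p l i) | v s. v \<in> S \<and> (\<forall>l<d. convergent_series (s l))} (k + d)"
  using p
proof (induction d)
  case 0
  then show ?case using S by simp
next
  case (Suc d)
  let ?S = "\<lambda>d. {\<lambda>i. v i + (\<Sum>l<d. s l * p l i) | v s. v \<in> S \<and> (\<forall>l<d. convergent_series (s l))}"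
  have "minors_in I N {\<lambda>i. v i + s * p d i | v s. v \<in> ?S d \<and> convergent_series s} (Suc (k + d))"
    by (rule minors_in_add_vector[OF I Suc.IH])
      (use Suc.prems conv in \<open>auto intro!: convergent_series_add convergent_series_sum convergent_series_mult\<close>)
  moreover have "?S (Suc d) \<subseteq> {\<lambda>i. v i + s * p d i | v s. v \<in> ?S d \<and> convergent_series s}"
  proof
    fix u assume "u \<in> ?S (Suc d)"
    then obtain v s where "v \<in> S" "\<forall>l<Suc d. convergent_series (s l)"
      "u = (\<lambda>i. v i + (\<Sum>l<Suc d. s l * p l i))" by blast
    then have u: "(\<lambda>i. v i + (\<Sum>l<d. s l * p l i)) \<in> ?S d" "convergent_series (s d)"
      "u = (\<lambda>i. (v i + (\<Sum>l<d. s l * p l i)) + s d * p d i)"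
      by (blast intro: less_SucI, simp, simp add: add.assoc)
    show "u \<in> {\<lambda>i. v i + s * p d i | v s. v \<in> ?S d \<and> convergent_series s}"
      by (rule CollectI, rule exI[of _ "\<lambda>i. v i + (\<Sum>l<d. s l * p l i)"], rule exI[of _ "s d"])
        (rule conjI[OF u(3) conjI[OF u(1,2)]])
  qed
  ultimately show ?case by (simp only: add_Suc_right) (rule minors_in_mono)
qed

section \<open>Syzygies of two systems of generators\<close>

definition syzygies :: "nat \<Rightarrow> (nat \<Rightarrow> complex fps fps) \<Rightarrow> (nat \<Rightarrow> complex fps fps) set" where
  "syzygies n g = {v. (\<forall>i<n. convergent_series (v i)) \<and> (\<Sum>i<n. v i * g i) = 0}"

text \<open>A minor that uses a padded row has a zero row; all others are minors of the original
  vectors.\<close>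

lemma minors_in_padded:
  assumes I: "ideal I conv_ring" and S: "minors_in I n S k"
  shows "minors_in I N {\<lambda>i. if i < n then v i else 0 | v. v \<in> S} k"
  unfolding minors_in_def
proof (intro allI impI)
  fix r u assume r: "\<forall>i<k. r i < N" and u: "\<forall>j<k. u j \<in> {\<lambda>i. if i < n then v i else 0 | v. v \<in> S}"
  show "minor k r u \<in> I"
  proof (cases "\<forall>i<k. r i < n")
    case True
    have "\<forall>j. \<exists>v. j < k \<longrightarrow> v \<in> S \<and> u j = (\<lambda>i. if i < n then v i else 0)" using u by blast
    from choice[OF this] obtain v where v: "\<And>j. j < k \<Longrightarrow> v j \<in> S \<and> u j = (\<lambda>i. if i < n then v j i else 0)"
      by blast
    have "minor k r u = minor k r v"
      by (rule minor_cong) (use v True in auto)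
    also have "\<dots> \<in> I" by (rule minors_inD[OF S]) (use v True in auto)
    finally show ?thesis .
  next
    case False
    then obtain i where i: "i < k" "\<not> r i < n" by blast
    have "minor k r u = 0"
    proof (rule minor_zero_row[OF i(1)])
      fix j assume "j < k"
      then obtain v where "u j = (\<lambda>i. if i < n then v i else 0)" using u by blast
      then show "u j (r i) = 0" using i by simp
    qed
    then show ?thesis using ideal_conv_0[OF I] by simp
  qed
qed

text \<open>The part of Fitting's lemma needed here: both \<open>g\<close> and \<open>h\<close> generate the same ideal. The
  \<open>(n + 1)\<close>-minors of the syzygies of the concatenated system of generators lie in the ideal of
  the \<open>(n + 1 - d)\<close>-minors of the syzygies of \<open>g\<close>, and the syzygies expressing \<open>g\<close> through \<open>h\<close>
  together with \<open>\<sigma>\<close> form a triangular matrix with diagonal \<open>1, \<dots>, 1, \<sigma> j\<close>.\<close>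

lemma syzygy_entry_in_minors:
  assumes I: "ideal I conv_ring"
    and S: "minors_in I n (syzygies n g) (Suc n - d)"
    and P: "\<And>i l. i < n \<Longrightarrow> l < d \<Longrightarrow> convergent_series (P i l)"
    and Q: "\<And>i l. i < n \<Longrightarrow> l < d \<Longrightarrow> convergent_series (Q l i)"
    and h: "\<And>l. l < d \<Longrightarrow> h l = (\<Sum>i<n. P i l * g i)"
    and g: "\<And>i. i < n \<Longrightarrow> g i = (\<Sum>l<d. Q l i * h l)"
    and \<sigma>: "\<sigma> \<in> syzygies d h" and j: "j < d"
  shows "\<sigma> j \<in> I"
proof (cases "d \<le> Suc n")
  case False
  \<comment> \<open>The truncated difference \<open>Suc n - d\<close> is 0 here, and the empty minor
    1 makes I the whole ring.\<close>
  have "minor 0 id (\<lambda>_. undefined) \<in> I"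
    by (rule minors_inD[OF S[unfolded diff_is_0_eq'[OF less_imp_le[OF False[unfolded not_le]]]]]) auto
  then have "1 \<in> I" by (simp add: minor_0)
  moreover have "convergent_series (\<sigma> j)" using \<sigma> j by (simp add: syzygies_def)
  ultimately show ?thesis using ideal_conv_mult[OF I, of "\<sigma> j" 1] by simp
next
  case d: True
  define N where "N = n + d"
  let ?S = "{\<lambda>i. if i < n then v i else 0 | v. v \<in> syzygies n g}"
  \<comment> \<open>The relation that expresses \<open>h l\<close> through g, as a syzygy of the
    concatenated system g, h.\<close>
  define p where "p = (\<lambda>l i. if i < n then P i l else if i = n + l then - 1 else 0)"
  have \<sigma>': "\<And>l. l < d \<Longrightarrow> convergent_series (\<sigma> l)" "(\<Sum>l<d. \<sigma> l * h l) = 0"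
    using \<sigma> by (auto simp: syzygies_def)
  have "minors_in I N {\<lambda>i. v i + (\<Sum>l<d. s l * p l i) | v s. v \<in> ?S \<and> (\<forall>l<d. convergent_series (s l))}
      (Suc n - d + d)"
  proof (rule minors_in_add_vectors[OF I minors_in_padded[OF I S]])
    show "convergent_series (v i)" if "v \<in> ?S" for v i
      using that by (auto simp: syzygies_def convergent_series_0)
    show "convergent_series (p l i)" if "l < d" for l i
      using that P by (auto simp: p_def intro: convergent_series_0 convergent_series_uminus convergent_series_1)
  qed
  then have minors: "minors_in I N
      {\<lambda>i. v i + (\<Sum>l<d. s l * p l i) | v s. v \<in> ?S \<and> (\<forall>l<d. convergent_series (s l))} (Suc n)"
    using d by simp
  define lift where "lift = (\<lambda>v s i. (if i < n then v i else 0) + (\<Sum>l<d. s l * p l i))"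
  have lift_low: "lift v s i = v i + (\<Sum>l<d. s l * P i l)" if "i < n" for v s i
    using that by (simp add: lift_def p_def)
  have lift_high: "lift v s (n + l) = - s l" if "l < d" for v s l
    using that by (simp add: lift_def p_def if_distrib[of "\<lambda>x. _ * x"] sum.delta cong: if_cong)
  \<comment> \<open>After cancellation, the vector for c < n is the relation expressing
    \<open>g c\<close> through h: a unit vector on the first n positions, followed by the entries
    \<open>- Q l c\<close>. The last vector is zero on these positions, followed by \<sigma>. The
    sums with P only serve to exhibit these vectors as a syzygy of g plus a combination of the
    vectors p.\<close>
  define u where "u = (\<lambda>c. if c < n
    then lift (\<lambda>i. (if i = c then 1 else 0) - (\<Sum>l<d. Q l c * P i l)) (\<lambda>l. Q l c)
    else lift (\<lambda>i. \<Sum>l<d. \<sigma> l * P i l) (\<lambda>l. - \<sigma> l))"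
  define r where "r = (\<lambda>i. if i < n then i else n + j)"
  have comb: "(\<Sum>i<n. (\<Sum>l<d. s l * P i l) * g i) = (\<Sum>l<d. s l * h l)" for s
  proof -
    have "(\<Sum>i<n. (\<Sum>l<d. s l * P i l) * g i) = (\<Sum>l<d. \<Sum>i<n. s l * P i l * g i)"
      unfolding sum_distrib_right by (rule sum.swap)
    also have "\<dots> = (\<Sum>l<d. s l * h l)"
      by (simp add: h sum_distrib_left mult.assoc)
    finally show ?thesis .
  qed
  have "minor (Suc n) r u \<in> I"
  proof (rule minors_inD[OF minors])
    show "r i < N" for i using j by (auto simp: r_def N_def)
    have in_lift: "lift v s \<in> {\<lambda>i. v i + (\<Sum>l<d. s l * p l i) | v s. v \<in> ?S \<and> (\<forall>l<d. convergent_series (s l))}"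
      if "v \<in> syzygies n g" "\<forall>l<d. convergent_series (s l)" for v s
      using that unfolding lift_def
      by (intro CollectI exI[of _ "\<lambda>i. if i < n then v i else 0"] exI[of _ s]) auto
    show "u c \<in> {\<lambda>i. v i + (\<Sum>l<d. s l * p l i) | v s. v \<in> ?S \<and> (\<forall>l<d. convergent_series (s l))}"
      for c
    proof (cases "c < n")
      case True
      have "(\<lambda>i. (if i = c then 1 else 0) - (\<Sum>l<d. Q l c * P i l)) \<in> syzygies n g"
        unfolding syzygies_def
      proof (intro CollectI conjI allI impI)
        fix i assume "i < n"
        then show "convergent_series ((if i = c then 1 else 0) - (\<Sum>l<d. Q l c * P i l))"
          using P Q True by (intro convergent_series_diff convergent_series_sum convergent_series_mult)
            (auto intro: convergent_series_0 convergent_series_1)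
      next
        have "(\<Sum>i<n. (if i = c then 1 else 0) * g i) = g c"
          using True by (simp add: if_distrib[of "\<lambda>x. x * _"] sum.delta cong: if_cong)
        then show "(\<Sum>i<n. ((if i = c then 1 else 0) - (\<Sum>l<d. Q l c * P i l)) * g i) = 0"
          using comb[of "\<lambda>l. Q l c"] g[OF True] by (simp only: left_diff_distrib sum_subtractf) simp
      qed
      then show ?thesis
        unfolding u_def using True Q by (simp only: if_True) (intro in_lift, auto)
    next
      case False
      have "(\<lambda>i. \<Sum>l<d. \<sigma> l * P i l) \<in> syzygies n g"
        using comb[of \<sigma>] \<sigma>' P by (auto simp: syzygies_def intro!: convergent_series_sum convergent_series_mult)
      then show ?thesis
        unfolding u_def using False \<sigma>' by (simp only: if_False) (intro in_lift, auto intro: convergent_series_uminus)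
    qed
  qed
  also have "minor (Suc n) r u = \<sigma> j"
  proof -
    let ?A = "mat (Suc n) (Suc n) (\<lambda>(i, c). u c (r i))"
    have low: "u c i = (if i = c then 1 else 0)" if "i < n" for c i
      using that by (simp add: u_def lift_low sum_negf)
    have high: "u n (n + j) = \<sigma> j"
      using lift_high[OF j] by (simp add: u_def)
    have "det ?A = prod_list (diag_mat ?A)"
      by (rule det_lower_triangular[of "Suc n"]) (auto simp: r_def low)
    also have "\<dots> = (\<Prod>i<Suc n. u i (r i))"
      by (simp add: prod_list_diag_prod lessThan_atLeast0)
    also have "\<dots> = \<sigma> j"
      using high by (simp add: r_def low)
    finally show ?thesis by (simp add: minor_def)
  qed
  finally show ?thesis .
qed

text \<open>Repeated rows give determinant 0, and distinct rows can be sorted at the price of a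
  sign, which does not affect membership in an ideal.\<close>

lemma det_sorted_rows_in:
  fixes F :: "nat \<Rightarrow> nat \<Rightarrow> complex fps fps"
  assumes I: "ideal I conv_ring"
    and sorted: "\<And>r. r \<in> {..<k} \<rightarrow> {..<n} \<Longrightarrow> strict_mono_on {..<k} r \<Longrightarrow>
      det (mat k k (\<lambda>(i, j). F (r i) j)) \<in> I"
    and r: "r \<in> {..<k} \<rightarrow> {..<n}"
  shows "det (mat k k (\<lambda>(i, j). F (r i) j)) \<in> I"
proof (cases "inj_on r {..<k}")
  case False
  then obtain i j where ij: "i < k" "j < k" "i \<noteq> j" "r i = r j" by (auto simp: inj_on_def)
  have "det (mat k k (\<lambda>(i, j). F (r i) j)) = 0"
    by (rule det_identical_rows[of _ k i j]) (use ij in \<open>auto intro!: eq_vecI\<close>)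
  then show ?thesis using ideal_conv_0[OF I] by simp
next
  case True
  then have card: "card (r ` {..<k}) = k" by (simp add: card_image)
  obtain h where h: "bij_betw h {..<k} (r ` {..<k})" "strict_mono_on {..<k} h"
    using ex_bij_betw_strict_mono_card[of "r ` {..<k}"] card by auto
  define p where "p = (\<lambda>i. if i < k then inv_into {..<k} r (h i) else i)"
  have rp: "r (p i) = h i" if "i < k" for i
  proof -
    have "h i \<in> r ` {..<k}" using that bij_betwE[OF h(1)] by blast
    then show ?thesis using that by (simp add: p_def f_inv_into_f)
  qed
  have "bij_betw r {..<k} (r ` {..<k})" using True by (simp add: inj_on_imp_bij_betw)
  then have "bij_betw (inv_into {..<k} r \<circ> h) {..<k} {..<k}"
    using h(1) bij_betw_inv_into bij_betw_trans by blast
  then have "bij_betw p {0..<k} {0..<k}"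
    unfolding atLeast0LessThan by (rule bij_betw_cong[THEN iffD1, rotated]) (simp add: p_def)
  then have p: "p permutes {0..<k}"
    by (rule bij_imp_permutes) (simp add: p_def)
  let ?A = "mat k k (\<lambda>(i, j). F (r i) j)"
  have "det (mat k k (\<lambda>(i, j). ?A $$ (p i, j))) = signof p * det ?A"
    by (rule det_permute_rows[OF _ p]) simp
  moreover have "mat k k (\<lambda>(i, j). ?A $$ (p i, j)) = mat k k (\<lambda>(i, j). F (h i) j)"
    using rp permutes_in_image[OF p] by (intro eq_matI) auto
  ultimately have eq: "signof p * det ?A = det (mat k k (\<lambda>(i, j). F (h i) j))" by simp
  have "r ` {..<k} \<subseteq> {..<n}" using r by auto
  then have "h \<in> {..<k} \<rightarrow> {..<n}" using bij_betwE[OF h(1)] by (intro funcsetI) blast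
  then have mem: "signof p * det ?A \<in> I" unfolding eq using h(2) by (intro sorted)
  have "signof p * det ?A = det ?A \<or> signof p * det ?A = - det ?A" by (simp add: sign_def)
  then show ?thesis
  proof
    assume "signof p * det ?A = det ?A"
    then show ?thesis using mem by (rule subst)
  next
    assume "signof p * det ?A = - det ?A"
    then have "- det ?A \<in> I" using mem by (rule subst)
    then have "- (- det ?A) \<in> I" by (rule ideal_conv_uminus[OF I])
    then show ?thesis by (simp only: minus_minus)
  qed
qed

text \<open>Connects \<open>minors\<close>, with its increasing index maps, to
  \<open>minors_in\<close>: the rows are sorted directly and the columns after
  transposition.\<close>

lemma minors_in_sorted:
  fixes A :: "nat \<Rightarrow> nat \<Rightarrow> complex fps fps"
  assumes I: "ideal I conv_ring"
    and sorted: "\<And>r c. r \<in> {..<k} \<rightarrow> {..<n} \<Longrightarrow> strict_mono_on {..<k} r \<Longrightarrow>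
      c \<in> {..<k} \<rightarrow> {..<m} \<Longrightarrow> strict_mono_on {..<k} c \<Longrightarrow>
      det (mat k k (\<lambda>(i, j). A (r i) (c j))) \<in> I"
  shows "minors_in I n ((\<lambda>c i. A i c) ` {..<m}) k"
  unfolding minors_in_def
proof (intro allI impI)
  fix r v assume r: "\<forall>i<k. r i < n" and v: "\<forall>j<k. v j \<in> (\<lambda>c i. A i c) ` {..<m}"
  then have "\<forall>j. \<exists>c. j < k \<longrightarrow> c < m \<and> v j = (\<lambda>i. A i c)" by blast
  from choice[OF this] obtain c where c: "\<And>j. j < k \<Longrightarrow> c j < m \<and> v j = (\<lambda>i. A i (c j))" by blast
  have rows: "det (mat k k (\<lambda>(i, j). A (s i) (d j))) \<in> I"
    if "s \<in> {..<k} \<rightarrow> {..<n}" "d \<in> {..<k} \<rightarrow> {..<m}" "strict_mono_on {..<k} d" for s d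
    using det_sorted_rows_in[OF I, of k n "\<lambda>i j. A i (d j)" s] sorted that by blast
  have "det (mat k k (\<lambda>(j, i). A (r i) (c j))) \<in> I"
  proof (rule det_sorted_rows_in[OF I, of k m "\<lambda>j i. A (r i) j"])
    show "c \<in> {..<k} \<rightarrow> {..<m}" using c by auto
    fix d assume d: "d \<in> {..<k} \<rightarrow> {..<m}" "strict_mono_on {..<k} d"
    have "det (mat k k (\<lambda>(j, i). A (r i) (d j))) = det (mat k k (\<lambda>(i, j). A (r i) (d j)))"
      by (subst det_transpose[symmetric, of _ k]) (auto intro!: arg_cong[of _ _ det] eq_matI)
    then show "det (mat k k (\<lambda>(j, i). A (r i) (d j))) \<in> I" using rows[OF _ d] r by auto
  qed
  also have "det (mat k k (\<lambda>(j, i). A (r i) (c j))) = minor k r v"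
    unfolding minor_def
    by (subst det_transpose[symmetric, of _ k]) (use c in \<open>auto intro!: arg_cong[of _ _ det] eq_matI\<close>)
  finally show "minor k r v \<in> I" .
qed

section \<open>Presentations of ideals\<close>

lemma finsum_conv_ring:
  assumes "finite S" "\<And>i. i \<in> S \<Longrightarrow> convergent_series (F i)"
  shows "finsum conv_ring F S = sum F S"
  using assms by (induction S rule: finite_induct) (auto simp: conv.finsum_insert Pi_def)

lemma finprod_conv_ring:
  assumes "finite S" "\<And>i. i \<in> S \<Longrightarrow> convergent_series (F i)"
  shows "finprod conv_ring F S = prod F S"
  using assms by (induction S rule: finite_induct) (auto simp: conv.finprod_insert Pi_def)

lemma finsum_ideal_module:
  assumes I: "ideal I conv_ring" and "finite S" "\<And>i. i \<in> S \<Longrightarrow> F i \<in> I"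
  shows "finsum (ideal_module conv_ring I) F S = sum F S"
proof -
  interpret M: abelian_monoid "ideal_module conv_ring I"
    by (rule abelian_monoidI)
      (auto simp: ideal_module_def ideal_conv_0[OF I] ideal_conv_add[OF I] add_ac)
  show ?thesis
    using assms(2,3)
  proof (induction S rule: finite_induct)
    case empty
    have "finsum (ideal_module conv_ring I) F {} = \<zero>\<^bsub>ideal_module conv_ring I\<^esub>"
      by (rule M.finsum_empty)
    then show ?case by (simp only: sum.empty) (simp add: ideal_module_def)
  next
    case (insert i S)
    then have "finsum (ideal_module conv_ring I) F (insert i S)
        = F i \<oplus>\<^bsub>ideal_module conv_ring I\<^esub> finsum (ideal_module conv_ring I) F S"
      by (intro M.finsum_insert) (auto simp: ideal_module_def)
    then show ?case using insert by (simp add: ideal_module_def)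
  qed
qed

lemma convergent_series_det:
  assumes "A \<in> carrier_mat k k" "\<And>i j. i < k \<Longrightarrow> j < k \<Longrightarrow> convergent_series (A $$ (i, j))"
  shows "convergent_series (det A)"
  unfolding det_def'[OF assms(1)]
proof (intro convergent_series_sum convergent_series_mult convergent_series_prod)
  fix p i assume p: "p \<in> {p. p permutes {0..<k}}"
  show "convergent_series (signof p)"
    by (auto simp: sign_def intro: convergent_series_1 convergent_series_uminus)
  assume i: "i \<in> {0..<k}"
  have "p i \<in> {0..<k}" using p i by (simp add: permutes_in_image)
  then show "convergent_series (A $$ (i, p i))" using i by (intro assms(2)) auto
qed

lemma matrix_det_conv_ring:
  assumes A: "\<And>i j. i < k \<Longrightarrow> j < k \<Longrightarrow> convergent_series (A i j)"
  shows "matrix_det conv_ring k A = det (mat k k (\<lambda>(i, j). A i j))"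
proof -
  have prod: "finprod conv_ring (\<lambda>i. A i (p i)) {..<k} = (\<Prod>i<k. A i (p i))"
    if "p permutes {..<k}" for p
    by (rule finprod_conv_ring) (use that A permutes_in_image[OF that] in auto)
  have conv: "convergent_series (\<Prod>i<k. A i (p i))" if "p permutes {..<k}" for p
    by (rule convergent_series_prod) (use that A permutes_in_image[OF that] in auto)
  have m1: "\<ominus>\<^bsub>conv_ring\<^esub> 1 = (- 1 :: complex fps fps)"
    by (rule conv_ring_uminus[OF convergent_series_1])
  have "matrix_det conv_ring k A
      = (\<Sum>p | p permutes {..<k}. (if evenperm p then 1 else - 1) * (\<Prod>i<k. A i (p i)))"
    unfolding matrix_det_def conv_ring_simps m1
    by (subst finsum_conv_ring)
      (auto simp: finite_permutations prod conv intro!: convergent_series_mult conv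
        intro: convergent_series_1 convergent_series_uminus)
  also have "\<dots> = (\<Sum>p | p permutes {0..<k}. signof p * (\<Prod>i = 0..<k. mat k k (\<lambda>(i, j). A i j) $$ (i, p i)))"
    unfolding lessThan_atLeast0
    by (intro sum.cong refl arg_cong2[of _ _ _ _ "(*)"] prod.cong)
      (auto simp: sign_def permutes_in_image[of _ "{0..<k}", simplified])
  also have "\<dots> = det (mat k k (\<lambda>(i, j). A i j))"
    by (rule det_def'[symmetric]) simp
  finally show ?thesis .
qed

lemma generator_map_ideal_module:
  assumes I: "ideal I conv_ring" and "\<And>i. i < n \<Longrightarrow> g i \<in> I" "\<And>i. i < n \<Longrightarrow> convergent_series (v i)"
  shows "generator_map (ideal_module conv_ring I) n g v = (\<Sum>i<n. v i * g i)"
proof -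
  have "finsum (ideal_module conv_ring I) (\<lambda>i. v i * g i) {..<n} = (\<Sum>i<n. v i * g i)"
    by (rule finsum_ideal_module[OF I]) (use assms ideal_conv_mult[OF I] in auto)
  then show ?thesis by (simp add: generator_map_def ideal_module_def)
qed

lemma matrix_map_conv_ring:
  assumes "\<And>i j. i < n \<Longrightarrow> j < m \<Longrightarrow> convergent_series (A i j)" "\<And>j. j < m \<Longrightarrow> convergent_series (w j)"
    "i < n"
  shows "matrix_map conv_ring n m A w i = (\<Sum>j<m. A i j * w j)"
proof -
  have "finsum conv_ring (\<lambda>j. A i j * w j) {..<m} = (\<Sum>j<m. A i j * w j)"
    by (rule finsum_conv_ring) (use assms in \<open>auto intro: convergent_series_mult\<close>)
  then show ?thesis using assms(3) by (simp add: matrix_map_def)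
qed

lemma free_vectors_conv_ring:
  "v \<in> free_vectors conv_ring n \<longleftrightarrow> (\<forall>i<n. convergent_series (v i)) \<and> v \<in> extensional {..<n}"
  by (auto simp: free_vectors_def PiE_def Pi_def)

text \<open>Exactness in the middle splits into two statements that ignore values outside the index
  range: the columns, being the images of the unit vectors, are syzygies, and they generate all
  syzygies.\<close>

lemma presentation_conv_ring_iff:
  assumes I: "ideal I conv_ring"
  shows "presentation conv_ring (ideal_module conv_ring I) n m A g \<longleftrightarrow>
    (\<forall>i<n. \<forall>j<m. convergent_series (A i j)) \<and> (\<forall>i<n. g i \<in> I) \<and>
    (\<forall>c<m. (\<lambda>i. A i c) \<in> syzygies n g) \<and>
    (\<forall>v\<in>syzygies n g. \<exists>w. (\<forall>c<m. convergent_series (w c)) \<and> (\<forall>i<n. v i = (\<Sum>c<m. A i c * w c))) \<and>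
    (\<forall>a\<in>I. \<exists>v. (\<forall>i<n. convergent_series (v i)) \<and> a = (\<Sum>i<n. v i * g i))"
  (is "?P \<longleftrightarrow> ?A \<and> ?g \<and> ?cols \<and> ?syz \<and> ?gen")
proof -
  have gen_map: "generator_map (ideal_module conv_ring I) n g v = (\<Sum>i<n. v i * g i)"
    if ?g "\<forall>i<n. convergent_series (v i)" for v
    by (rule generator_map_ideal_module[OF I]) (use that in auto)
  have mat_map: "matrix_map conv_ring n m A w i = (\<Sum>c<m. A i c * w c)"
    if ?A "\<forall>c<m. convergent_series (w c)" "i < n" for w i
    by (rule matrix_map_conv_ring) (use that in auto)
  have zero: "\<zero>\<^bsub>ideal_module conv_ring I\<^esub> = 0" and carrier: "carrier (ideal_module conv_ring I) = I"
    by (simp_all add: ideal_module_def)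
  have syz: "v \<in> {v \<in> free_vectors conv_ring n. generator_map (ideal_module conv_ring I) n g v = 0}
      \<longleftrightarrow> v \<in> syzygies n g \<and> v \<in> extensional {..<n}" if ?g for v
    using gen_map[OF that] by (auto simp: free_vectors_conv_ring syzygies_def)
  have syz_restrict: "restrict v {..<n} \<in> syzygies n g \<longleftrightarrow> v \<in> syzygies n g" for v
    by (simp add: syzygies_def)
  show ?thesis
  proof
    assume P: ?P
    then have A: ?A and g: ?g
      and im: "matrix_map conv_ring n m A ` free_vectors conv_ring m =
        {v \<in> free_vectors conv_ring n. generator_map (ideal_module conv_ring I) n g v = 0}"
      and surj: "generator_map (ideal_module conv_ring I) n g ` free_vectors conv_ring n = I"
      by (auto simp: presentation_def zero carrier)
    have ?cols
    proof (intro allI impI)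
      fix c assume c: "c < m"
      define w where "w = (\<lambda>j\<in>{..<m}. if j = c then 1 else 0 :: complex fps fps)"
      have w: "w \<in> free_vectors conv_ring m" "\<forall>j<m. convergent_series (w j)"
        by (auto simp: w_def free_vectors_conv_ring convergent_series_0 convergent_series_1)
      have "matrix_map conv_ring n m A w \<in> matrix_map conv_ring n m A ` free_vectors conv_ring m"
        using w(1) by (rule imageI)
      then have "matrix_map conv_ring n m A w \<in> syzygies n g" unfolding im syz[OF g] by (rule conjunct1)
      moreover have "matrix_map conv_ring n m A w i = A i c" if "i < n" for i
      proof -
        have "matrix_map conv_ring n m A w i = (\<Sum>j<m. A i j * w j)"
          by (rule mat_map[OF A w(2) that])
        also have "\<dots> = (\<Sum>j<m. A i j * (if j = c then 1 else 0))"
          by (intro sum.cong) (auto simp: w_def)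
        also have "\<dots> = A i c"
          using c by (simp add: if_distrib[of "\<lambda>x. _ * x"] sum.delta cong: if_cong)
        finally show ?thesis .
      qed
      ultimately show "(\<lambda>i. A i c) \<in> syzygies n g" by (simp add: syzygies_def)
    qed
    moreover have ?syz
    proof
      fix v assume v: "v \<in> syzygies n g"
      then have "restrict v {..<n} \<in> matrix_map conv_ring n m A ` free_vectors conv_ring m"
        unfolding im syz[OF g] by (simp add: syz_restrict)
      then obtain w where w: "w \<in> free_vectors conv_ring m" "restrict v {..<n} = matrix_map conv_ring n m A w"
        by blast
      have w': "\<forall>c<m. convergent_series (w c)" using w(1) by (simp add: free_vectors_conv_ring)
      have "v i = (\<Sum>c<m. A i c * w c)" if "i < n" for i
        using fun_cong[OF w(2), of i] mat_map[OF A w' that] that by simp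
      then show "\<exists>w. (\<forall>c<m. convergent_series (w c)) \<and> (\<forall>i<n. v i = (\<Sum>c<m. A i c * w c))"
        using w' by blast
    qed
    moreover have ?gen
    proof
      fix a assume "a \<in> I"
      then obtain v where v: "v \<in> free_vectors conv_ring n" "a = generator_map (ideal_module conv_ring I) n g v"
        using surj by blast
      then show "\<exists>v. (\<forall>i<n. convergent_series (v i)) \<and> a = (\<Sum>i<n. v i * g i)"
        using gen_map[OF g, of v] by (auto simp: free_vectors_conv_ring)
    qed
    ultimately show "?A \<and> ?g \<and> ?cols \<and> ?syz \<and> ?gen" using A g by blast
  next
    assume "?A \<and> ?g \<and> ?cols \<and> ?syz \<and> ?gen"
    then have A: ?A and g: ?g and cols: ?cols and syzs: ?syz and gen: ?gen by blast+
    have "matrix_map conv_ring n m A ` free_vectors conv_ring m =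
        {v \<in> free_vectors conv_ring n. generator_map (ideal_module conv_ring I) n g v = 0}" (is "?L = ?R")
    proof (intro equalityI subsetI)
      fix v assume "v \<in> ?L"
      then obtain w where w: "\<forall>c<m. convergent_series (w c)" "v = matrix_map conv_ring n m A w"
        by (auto simp: free_vectors_conv_ring)
      have v: "v i = (\<Sum>c<m. A i c * w c)" if "i < n" for i
        using mat_map[OF A w(1) that] w(2) by simp
      have "(\<Sum>i<n. v i * g i) = (\<Sum>i<n. \<Sum>c<m. w c * (A i c * g i))"
        by (simp add: v sum_distrib_left sum_distrib_right mult_ac)
      also have "\<dots> = (\<Sum>c<m. w c * (\<Sum>i<n. A i c * g i))"
        unfolding sum_distrib_left by (rule sum.swap)
      also have "\<dots> = 0" using cols by (simp add: syzygies_def)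
      finally have "v \<in> syzygies n g"
        using v A w(1) by (auto simp: syzygies_def intro!: convergent_series_sum convergent_series_mult)
      moreover have "v \<in> extensional {..<n}" by (simp add: w(2) matrix_map_def)
      ultimately show "v \<in> ?R" unfolding syz[OF g] by blast
    next
      fix v assume "v \<in> ?R"
      then have v: "v \<in> syzygies n g" "v \<in> extensional {..<n}" unfolding syz[OF g] by blast+
      then obtain w where w: "\<forall>c<m. convergent_series (w c)" "\<forall>i<n. v i = (\<Sum>c<m. A i c * w c)"
        using syzs by blast
      let ?w = "restrict w {..<m}"
      have "v = matrix_map conv_ring n m A ?w"
      proof (rule extensionalityI[OF v(2)])
        show "matrix_map conv_ring n m A ?w \<in> extensional {..<n}" by (simp add: matrix_map_def)
        show "v i = matrix_map conv_ring n m A ?w i" if "i \<in> {..<n}" for i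
          using mat_map[OF A, of ?w i] w that by simp
      qed
      moreover have "?w \<in> free_vectors conv_ring m" using w by (simp add: free_vectors_conv_ring)
      ultimately show "v \<in> ?L" by blast
    qed
    moreover have "generator_map (ideal_module conv_ring I) n g ` free_vectors conv_ring n = I"
    proof (intro equalityI subsetI)
      fix a assume "a \<in> generator_map (ideal_module conv_ring I) n g ` free_vectors conv_ring n"
      then obtain v where "\<forall>i<n. convergent_series (v i)" "a = (\<Sum>i<n. v i * g i)"
        using gen_map[OF g] by (auto simp: free_vectors_conv_ring)
      then show "a \<in> I"
        using g by (auto intro!: ideal_conv_sum[OF I] ideal_conv_mult[OF I])
    next
      fix a assume "a \<in> I"
      then obtain v where v: "\<forall>i<n. convergent_series (v i)" "a = (\<Sum>i<n. v i * g i)"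
        using gen by blast
      have "a = generator_map (ideal_module conv_ring I) n g (restrict v {..<n})"
        using gen_map[OF g, of "restrict v {..<n}"] v by simp
      moreover have "restrict v {..<n} \<in> free_vectors conv_ring n" using v by (simp add: free_vectors_conv_ring)
      ultimately show "a \<in> generator_map (ideal_module conv_ring I) n g ` free_vectors conv_ring n" by blast
    qed
    ultimately show ?P
      using A g by (simp add: presentation_def zero carrier)
  qed
qed

lemma minors_conv_ring:
  assumes "\<And>i j. i < n \<Longrightarrow> j < m \<Longrightarrow> convergent_series (A i j)"
  shows "minors conv_ring n m A k = {det (mat k k (\<lambda>(i, j). A (r i) (c j))) | r c.
    r \<in> {..<k} \<rightarrow> {..<n} \<and> strict_mono_on {..<k} r \<and> c \<in> {..<k} \<rightarrow> {..<m} \<and> strict_mono_on {..<k} c}"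
proof -
  have "matrix_det conv_ring k (\<lambda>i j. A (r i) (c j)) = det (mat k k (\<lambda>(i, j). A (r i) (c j)))"
    if "r \<in> {..<k} \<rightarrow> {..<n}" "c \<in> {..<k} \<rightarrow> {..<m}" for r c
    by (rule matrix_det_conv_ring) (use that assms in auto)
  then show ?thesis unfolding minors_def by (intro Collect_cong) metis
qed

lemma minors_conv_ring_subset:
  assumes A: "\<And>i j. i < n \<Longrightarrow> j < m \<Longrightarrow> convergent_series (A i j)"
  shows "minors conv_ring n m A k \<subseteq> carrier conv_ring"
proof
  have eq: "minors conv_ring n m A k = {det (mat k k (\<lambda>(i, j). A (r i) (c j))) | r c.
    r \<in> {..<k} \<rightarrow> {..<n} \<and> strict_mono_on {..<k} r \<and> c \<in> {..<k} \<rightarrow> {..<m} \<and> strict_mono_on {..<k} c}"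
    by (rule minors_conv_ring) (rule A)
  fix x assume "x \<in> minors conv_ring n m A k"
  then obtain r c where "x = det (mat k k (\<lambda>(i, j). A (r i) (c j)))"
    "r \<in> {..<k} \<rightarrow> {..<n}" "c \<in> {..<k} \<rightarrow> {..<m}"
    unfolding eq by blast
  then show "x \<in> carrier conv_ring"
    by (auto simp: Pi_iff intro!: convergent_series_det A)
qed

text \<open>The constant terms of the vectors of a minor, together with those of the \<open>d\<close> columns of
  \<open>P\<close>, are linearly dependent; as \<open>Q P\<close> is the identity and \<open>Q A\<close> is zero at the origin, the
  relation only involves the columns of the minor.\<close>

lemma minor_at_origin:
  assumes A: "\<And>c. c < m \<Longrightarrow> (\<lambda>i. A i c) \<in> syzygies n g"
    and P: "\<And>i l. i < n \<Longrightarrow> l < d \<Longrightarrow> convergent_series (P i l)"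
    and Q: "\<And>i l. i < n \<Longrightarrow> l < d \<Longrightarrow> convergent_series (Q l i)"
    and h: "\<And>l. l < d \<Longrightarrow> h l = (\<Sum>i<n. P i l * g i)"
    and g: "\<And>i. i < n \<Longrightarrow> g i = (\<Sum>l<d. Q l i * h l)"
    and min: "\<And>\<sigma> l. \<sigma> \<in> syzygies d h \<Longrightarrow> l < d \<Longrightarrow> coef (\<sigma> l) 0 0 = 0"
    and k: "n < k + d"
    and r: "r \<in> {..<k} \<rightarrow> {..<n}" and c: "c \<in> {..<k} \<rightarrow> {..<m}"
  shows "coef (det (mat k k (\<lambda>(i, j). A (r i) (c j)))) 0 0 = 0"
proof (rule ccontr)
  define ev where "ev = (\<lambda>F :: complex fps fps. coef F 0 0)"
  interpret ev: comm_ring_hom ev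
    by unfold_locales (simp_all add: ev_def)
  let ?B = "mat k k (\<lambda>(i, j). A (r i) (c j))"
  assume "coef (det ?B) 0 0 \<noteq> 0"
  then have "ev (det ?B) \<noteq> 0" by (simp add: ev_def)
  then have det: "det (map_mat ev ?B) \<noteq> 0" by (simp only: ev.hom_det not_False_eq_True)
  \<comment> \<open>Since Q writes g through h, it carries the syzygy in column b to a syzygy of h,
    whose entries vanish at the origin by \<open>min\<close>.\<close>
  have QA: "(\<Sum>i<n. ev (Q l i) * ev (A i b)) = 0" if "b < m" "l < d" for b l
  proof -
    have "(\<lambda>l. \<Sum>i<n. Q l i * A i b) \<in> syzygies d h"
    proof -
      have "(\<Sum>l<d. (\<Sum>i<n. Q l i * A i b) * h l) = (\<Sum>l<d. \<Sum>i<n. A i b * (Q l i * h l))"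
        by (simp add: sum_distrib_left sum_distrib_right mult_ac)
      also have "\<dots> = (\<Sum>i<n. A i b * (\<Sum>l<d. Q l i * h l))"
        unfolding sum_distrib_left by (rule sum.swap)
      also have "\<dots> = (\<Sum>i<n. A i b * g i)" by (simp add: g[symmetric])
      also have "\<dots> = 0" using A[OF that(1)] by (simp add: syzygies_def)
      finally show ?thesis
        using A[OF that(1)] Q by (auto simp: syzygies_def intro!: convergent_series_sum convergent_series_mult)
    qed
    from min[OF this that(2)] show ?thesis by (simp add: ev_def fps_sum_nth)
  qed
  \<comment> \<open>Writing h through g and g back through h returns h, so each column of the
    identity minus Q P is a syzygy of h and vanishes at the origin by \<open>min\<close>.\<close>
  have QP: "(\<Sum>i<n. ev (Q l' i) * ev (P i l)) = (if l' = l then 1 else 0)" if "l < d" "l' < d" for l l'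
  proof -
    have "(\<lambda>l'. (if l' = l then 1 else 0) - (\<Sum>i<n. Q l' i * P i l)) \<in> syzygies d h"
    proof -
      have "(\<Sum>l'<d. (\<Sum>i<n. Q l' i * P i l) * h l') = (\<Sum>l'<d. \<Sum>i<n. P i l * (Q l' i * h l'))"
        by (simp add: sum_distrib_left sum_distrib_right mult_ac)
      also have "\<dots> = (\<Sum>i<n. P i l * (\<Sum>l'<d. Q l' i * h l'))"
        unfolding sum_distrib_left by (rule sum.swap)
      also have "\<dots> = h l" by (simp add: g[symmetric] h[OF that(1)])
      finally have "(\<Sum>l'<d. (\<Sum>i<n. Q l' i * P i l) * h l') = h l" .
      moreover have "(\<Sum>l'<d. (if l' = l then 1 else 0) * h l') = h l"
        using that by (simp add: if_distrib[of "\<lambda>x. x * _"] sum.delta cong: if_cong)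
      ultimately have "(\<Sum>l'<d. ((if l' = l then 1 else 0) - (\<Sum>i<n. Q l' i * P i l)) * h l') = 0"
        by (simp only: left_diff_distrib sum_subtractf) simp
      then show ?thesis
        using P Q that by (auto simp: syzygies_def intro!: convergent_series_diff convergent_series_sum
            convergent_series_mult convergent_series_0 convergent_series_1 convergent_series_uminus)
    qed
    from min[OF this that(2)] show ?thesis by (simp add: ev_def fps_sum_nth split: if_splits)
  qed
  define M where "M = (\<lambda>j i. if j < k then ev (A i (c j)) else ev (P i (j - k)))"
  obtain s where s: "\<exists>j<k + d. s j \<noteq> 0" "\<And>i. i < n \<Longrightarrow> (\<Sum>j<k + d. s j * M j i) = 0"
    using homogeneous_system_nontrivial[OF k, of M] by blast
  have shift: "(\<Sum>j<k + e. F j) = (\<Sum>j<k. F j) + (\<Sum>l<e. F (k + l))" for F :: "nat \<Rightarrow> complex" and e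
    by (induction e) (simp_all add: add.assoc)
  have split: "(\<Sum>j<k + d. s j * M j i) = (\<Sum>j<k. s j * ev (A i (c j))) + (\<Sum>l<d. s (k + l) * ev (P i l))" for i
    unfolding shift by (simp add: M_def)
  \<comment> \<open>Row l of Q, applied to the relation, annihilates the columns of A and isolates
    this coefficient.\<close>
  have tail: "s (k + l) = 0" if "l < d" for l
  proof -
    have "0 = (\<Sum>i<n. ev (Q l i) * (\<Sum>j<k + d. s j * M j i))" using s(2) by simp
    also have "\<dots> = (\<Sum>i<n. \<Sum>j<k. s j * (ev (Q l i) * ev (A i (c j))))
        + (\<Sum>i<n. \<Sum>l'<d. s (k + l') * (ev (Q l i) * ev (P i l')))"
      unfolding split by (simp add: distrib_left sum.distrib sum_distrib_left mult_ac)
    also have "(\<Sum>i<n. \<Sum>j<k. s j * (ev (Q l i) * ev (A i (c j))))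
        = (\<Sum>j<k. s j * (\<Sum>i<n. ev (Q l i) * ev (A i (c j))))"
      unfolding sum_distrib_left by (rule sum.swap)
    also have "\<dots> = 0" using c that by (intro sum.neutral) (auto simp: QA Pi_iff)
    also have "(\<Sum>i<n. \<Sum>l'<d. s (k + l') * (ev (Q l i) * ev (P i l')))
        = (\<Sum>l'<d. s (k + l') * (\<Sum>i<n. ev (Q l i) * ev (P i l')))"
      unfolding sum_distrib_left by (rule sum.swap)
    also have "\<dots> = (\<Sum>l'<d. if l' = l then s (k + l') else 0)"
      using that by (intro sum.cong refl) (auto simp: QP)
    also have "\<dots> = s (k + l)" using that by (simp add: sum.delta)
    finally show ?thesis by simp
  qed
  have rows: "(\<Sum>j<k. s j * ev (A i (c j))) = 0" if "i < n" for i
    using s(2)[OF that] tail by (simp add: split)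
  define v where "v = vec k s"
  have "map_mat ev ?B *\<^sub>v v = 0\<^sub>v k"
  proof (rule eq_vecI)
    fix i assume "i < dim_vec (0\<^sub>v k :: complex vec)"
    then have i: "i < k" by simp
    then have "(map_mat ev ?B *\<^sub>v v) $ i = (\<Sum>j<k. s j * ev (A (r i) (c j)))"
      by (simp add: v_def scalar_prod_def lessThan_atLeast0 mult.commute)
    also have "\<dots> = 0" using r i by (intro rows) auto
    finally show "(map_mat ev ?B *\<^sub>v v) $ i = 0\<^sub>v k $ i" using i by simp
  qed simp
  moreover have "v \<noteq> 0\<^sub>v k"
  proof -
    obtain j where j: "j < k + d" "s j \<noteq> 0" using s(1) by blast
    have "j < k"
    proof (rule ccontr)
      assume "\<not> j < k"
      then have "j - k < d" "k + (j - k) = j" using j by auto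
      then show False using tail[of "j - k"] j by simp
    qed
    then have "v $ j \<noteq> 0\<^sub>v k $ j" using j by (simp add: v_def)
    then show ?thesis by auto
  qed
  moreover have "v \<in> carrier_vec k" by (simp add: v_def)
  ultimately have "det (map_mat ev ?B) = 0"
    using det_0_iff_vec_prod_zero_field[of "map_mat ev ?B" k] by auto
  then show False using det by blast
qed

section \<open>Jacobian and Tjurina ideals\<close>

lemma genideal_finite:
  fixes d :: nat
  assumes h: "\<And>l. l < d \<Longrightarrow> convergent_series (h l)"
  shows "Idl\<^bsub>conv_ring\<^esub> (h ` {..<d}) = {\<Sum>l<d. a l * h l | a. \<forall>l<d. convergent_series (a l)}" (is "?L = ?R")
proof (rule antisym)
  have L: "ideal ?L conv_ring"
    by (rule conv.genideal_ideal) (use h in auto)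
  have "ideal ?R conv_ring"
    unfolding ideal_conv_iff
  proof (intro conjI subsetI ballI allI impI)
    fix x assume "x \<in> ?R"
    then show "x \<in> {F. convergent_series F}"
      using h by (auto intro!: convergent_series_sum convergent_series_mult)
  next
    show "0 \<in> ?R" by (rule CollectI, rule exI[of _ "\<lambda>_. 0"]) (simp add: convergent_series_0)
  next
    fix x y assume "x \<in> ?R" "y \<in> ?R"
    then obtain a b where "x = (\<Sum>l<d. a l * h l)" "y = (\<Sum>l<d. b l * h l)"
      "\<forall>l<d. convergent_series (a l)" "\<forall>l<d. convergent_series (b l)" by blast
    then show "x + y \<in> ?R"
      by (intro CollectI exI[of _ "\<lambda>l. a l + b l"])
        (simp add: distrib_right sum.distrib convergent_series_add)
  next
    fix r x assume "convergent_series r" "x \<in> ?R"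
    then obtain a where "x = (\<Sum>l<d. a l * h l)" "\<forall>l<d. convergent_series (a l)" by blast
    then show "r * x \<in> ?R"
      using \<open>convergent_series r\<close> by (intro CollectI exI[of _ "\<lambda>l. r * a l"])
        (simp add: sum_distrib_left mult.assoc convergent_series_mult)
  qed
  moreover have "h ` {..<d} \<subseteq> ?R"
  proof
    fix x assume "x \<in> h ` {..<d}"
    then obtain l0 where "l0 < d" "x = h l0" by blast
    then have "(\<Sum>l<d. (if l = l0 then 1 else 0) * h l) = x"
      by (simp add: if_distrib[of "\<lambda>x. x * _"] sum.delta cong: if_cong)
    then show "x \<in> ?R"
      by (intro CollectI exI[of _ "\<lambda>l. if l = l0 then 1 else 0"])
        (auto intro: convergent_series_0 convergent_series_1)
  qed
  ultimately show "?L \<subseteq> ?R" by (rule conv.genideal_minimal)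
  have "h ` {..<d} \<subseteq> carrier conv_ring" using h by auto
  from conv.genideal_self[OF this] have mem: "h l \<in> ?L" if "l < d" for l
    using that by blast
  show "?R \<subseteq> ?L"
    using mem by (auto intro!: ideal_conv_sum[OF L] ideal_conv_mult[OF L])
qed

text \<open>In this order the first two elements generate the Jacobian ideal, so one family serves
  both ideals. Indices beyond 2 repeat f.\<close>

definition tjurina_gens :: "complex fps fps \<Rightarrow> nat \<Rightarrow> complex fps fps" where
  "tjurina_gens f l = (if l = 0 then partial_x f else if l = 1 then partial_y f else f)"

lemma convergent_series_tjurina_gens: "convergent_series f \<Longrightarrow> convergent_series (tjurina_gens f l)"
  by (auto simp: tjurina_gens_def convergent_series_partial_x convergent_series_partial_y)

lemma sum_lessThan_3: "(\<Sum>l<3. F l) = F 0 + F 1 + F (2 :: nat)"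
  by (simp add: eval_nat_numeral)

lemma jacobian_ideal_eq:
  assumes "convergent_series f"
  shows "jacobian_ideal f =
    {a * partial_x f + b * partial_y f | a b. convergent_series a \<and> convergent_series b}"
proof -
  have "{partial_x f, partial_y f} = tjurina_gens f ` {..<2}"
    by (auto simp: tjurina_gens_def eval_nat_numeral lessThan_Suc)
  then have eq: "jacobian_ideal f = {\<Sum>l<2. a l * tjurina_gens f l | a. \<forall>l<2. convergent_series (a l)}"
    unfolding jacobian_ideal_def using assms by (simp add: genideal_finite convergent_series_tjurina_gens)
  show ?thesis
  proof (intro equalityI subsetI)
    fix x assume "x \<in> jacobian_ideal f"
    then obtain a where "x = (\<Sum>l<2. a l * tjurina_gens f l)" "\<forall>l<2. convergent_series (a l)"
      unfolding eq by blast
    then have "x = a 0 * partial_x f + a 1 * partial_y f" "convergent_series (a 0)" "convergent_series (a 1)"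
      by (simp_all add: tjurina_gens_def eval_nat_numeral)
    then show "x \<in> {a * partial_x f + b * partial_y f | a b. convergent_series a \<and> convergent_series b}"
      by blast
  next
    fix x assume "x \<in> {a * partial_x f + b * partial_y f | a b. convergent_series a \<and> convergent_series b}"
    then obtain a b where "x = a * partial_x f + b * partial_y f" "convergent_series a" "convergent_series b"
      by blast
    then show "x \<in> jacobian_ideal f"
      unfolding eq by (intro CollectI exI[of _ "\<lambda>l. if l = 0 then a else b"])
        (simp add: tjurina_gens_def eval_nat_numeral)
  qed
qed

lemma tjurina_ideal_eq:
  assumes "convergent_series f"
  shows "tjurina_ideal f = {\<Sum>l<3. a l * tjurina_gens f l | a. \<forall>l<3. convergent_series (a l)}"
proof -
  have "{partial_x f, partial_y f, f} = tjurina_gens f ` {..<3}"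
    by (auto simp: tjurina_gens_def eval_nat_numeral lessThan_Suc)
  then show ?thesis
    unfolding tjurina_ideal_def using assms by (simp add: genideal_finite convergent_series_tjurina_gens)
qed

lemma ideal_jacobian: "convergent_series f \<Longrightarrow> ideal (jacobian_ideal f) conv_ring"
  unfolding jacobian_ideal_def
  by (rule conv.genideal_ideal) (auto simp: convergent_series_partial_x convergent_series_partial_y)

lemma ideal_tjurina: "convergent_series f \<Longrightarrow> ideal (tjurina_ideal f) conv_ring"
  unfolding tjurina_ideal_def
  by (rule conv.genideal_ideal) (auto simp: convergent_series_partial_x convergent_series_partial_y)

lemma tjurina_gens_mem:
  assumes "convergent_series f"
  shows "partial_x f \<in> tjurina_ideal f" "partial_y f \<in> tjurina_ideal f" "f \<in> tjurina_ideal f"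
  using conv.genideal_self[of "{partial_x f, partial_y f, f}"] assms
  by (auto simp: tjurina_ideal_def convergent_series_partial_x convergent_series_partial_y)

lemma jacobian_gens_mem:
  assumes "convergent_series f"
  shows "partial_x f \<in> jacobian_ideal f" "partial_y f \<in> jacobian_ideal f"
  using conv.genideal_self[of "{partial_x f, partial_y f}"] assms
  by (auto simp: jacobian_ideal_def convergent_series_partial_x convergent_series_partial_y)

lemma jacobian_subset_tjurina:
  assumes "convergent_series f"
  shows "jacobian_ideal f \<subseteq> tjurina_ideal f"
  unfolding jacobian_ideal_def
  by (rule conv.genideal_minimal[OF ideal_tjurina]) (use assms tjurina_gens_mem in auto)

text \<open>The form in which \<open>reldim_image\<close> yields the image of multiplication by
  f.\<close>

lemma tjurina_ideal_eq_mult_add: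
  assumes "convergent_series f"
  shows "tjurina_ideal f = {v * f + j | v j. v \<in> {F. convergent_series F} \<and> j \<in> jacobian_ideal f}"
proof (intro equalityI subsetI)
  fix x assume "x \<in> tjurina_ideal f"
  then obtain a where a: "x = (\<Sum>l<3. a l * tjurina_gens f l)" "\<forall>l<3. convergent_series (a l)"
    unfolding tjurina_ideal_eq[OF assms] by blast
  have "x = a 2 * f + (a 0 * partial_x f + a 1 * partial_y f)"
    by (simp add: a(1) sum_lessThan_3 tjurina_gens_def)
  moreover have "a 0 * partial_x f + a 1 * partial_y f \<in> jacobian_ideal f"
    unfolding jacobian_ideal_eq[OF assms]
    using a(2) by (intro CollectI exI[of _ "a 0"] exI[of _ "a 1"]) simp
  moreover have "a 2 \<in> {F. convergent_series F}" using a(2) by auto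
  ultimately show "x \<in> {v * f + j | v j. v \<in> {F. convergent_series F} \<and> j \<in> jacobian_ideal f}" by blast
next
  fix x assume "x \<in> {v * f + j | v j. v \<in> {F. convergent_series F} \<and> j \<in> jacobian_ideal f}"
  then obtain v j where "x = v * f + j" "convergent_series v" "j \<in> jacobian_ideal f" by blast
  then show "x \<in> tjurina_ideal f"
    using ideal_tjurina[OF assms] tjurina_gens_mem[OF assms] jacobian_subset_tjurina[OF assms]
    by (auto intro: ideal_conv_add ideal_conv_mult)
qed

lemma ideal_ann:
  assumes "convergent_series f"
  shows "ideal (ann_ideal f) conv_ring"
  using ideal_convD[OF ideal_jacobian[OF assms]]
  unfolding ideal_conv_iff ann_ideal_def
  by (auto simp: distrib_right mult.assoc convergent_series_0
      intro: convergent_series_add convergent_series_mult)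

lemma jacobian_subset_ann:
  assumes "convergent_series f"
  shows "jacobian_ideal f \<subseteq> ann_ideal f"
proof
  fix x assume x: "x \<in> jacobian_ideal f"
  then have "f * x \<in> jacobian_ideal f" by (rule ideal_conv_mult[OF ideal_jacobian[OF assms] assms])
  then show "x \<in> ann_ideal f"
    using ideal_conv_convergent[OF ideal_jacobian[OF assms] x] by (simp add: ann_ideal_def mult.commute)
qed

text \<open>In a finite-dimensional quotient the powers of z satisfy a linear relation. Taking out
  its lowest power \<open>z ^ k\<close> leaves a factor with nonzero constant term, hence a
  unit.\<close>

lemma power_mem_of_reldim:
  assumes J: "ideal J conv_ring" and n: "cps.reldim J {F. convergent_series F} n"
    and z: "convergent_series z" "coef z 0 0 = 0"
  obtains k where "z ^ k \<in> J"
proof -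
  obtain c where c: "\<exists>i\<le>n. c i \<noteq> 0" "(\<Sum>i\<le>n. cst (c i) * z ^ i) \<in> J"
    by (rule cps.reldim_dependent[OF n ideal_subspace[OF J], of "\<lambda>i. z ^ i"])
      (use z convergent_series_power in auto)
  define k where "k = (LEAST i. c i \<noteq> 0)"
  obtain i0 where i0: "i0 \<le> n" "c i0 \<noteq> 0" using c(1) by blast
  have ck: "c k \<noteq> 0" and less: "\<And>i. i < k \<Longrightarrow> c i = 0" and kn: "k \<le> n"
    unfolding k_def using i0 not_less_Least LeastI[of "\<lambda>i. c i \<noteq> 0"] Least_le[of "\<lambda>i. c i \<noteq> 0"]
    by (blast, blast, meson le_trans)
  define U where "U = (\<Sum>i\<in>{k..n}. cst (c i) * z ^ (i - k))"
  have "(\<Sum>i\<le>n. cst (c i) * z ^ i) = (\<Sum>i\<in>{k..n}. cst (c i) * z ^ i)"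
    by (rule sum.mono_neutral_right) (use less in auto)
  also have "\<dots> = z ^ k * U"
    unfolding U_def sum_distrib_left
    by (intro sum.cong refl) (simp add: mult.left_commute flip: power_add)
  finally have zU: "z ^ k * U \<in> J" using c(2) by simp
  have "convergent_series U"
    unfolding U_def using z by (intro convergent_series_sum convergent_series_mult convergent_series_const convergent_series_power)
  moreover have "coef U 0 0 = (\<Sum>i\<in>{k..n}. if i = k then c i else 0)"
    unfolding U_def fps_sum_nth
    by (intro sum.cong refl) (use z(2) in \<open>auto simp: fps_nth_power_0 power_0_left\<close>)
  then have "coef U 0 0 \<noteq> 0" using ck kn by (simp add: sum.delta)
  ultimately obtain V where V: "convergent_series V" "U * V = 1"
    by (rule convergent_series_inverse)
  have "V * (z ^ k * U) = z ^ k" using V(2) by (metis mult.commute mult.left_commute mult_1_right)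
  then have "z ^ k \<in> J" using ideal_conv_mult[OF J V(1) zU] by (simp only:)
  then show ?thesis by (rule that)
qed

section \<open>Koszul relations and a presentation of the Tjurina ideal\<close>

lemma var_power_nonzero: "var_x ^ k \<noteq> 0" "var_y ^ k \<noteq> 0"
  by (auto simp: var_x_def var_y_def)

text \<open>Powers of \<open>x\<close> and of \<open>y\<close> in the ideal \<open>(p, q)\<close> annihilate the first Koszul homology of
  \<open>p\<close>, \<open>q\<close>, and they form a regular sequence.\<close>

lemma koszul_syzygy:
  assumes conv: "convergent_series \<alpha>" "convergent_series \<beta>" "convergent_series a" "convergent_series b"
    and x: "var_x ^ k = \<alpha> * p + \<beta> * q" and y: "var_y ^ l = \<gamma> * p + \<delta> * q"
    and syz: "a * p + b * q = 0"
  obtains u where "convergent_series u" "a = u * q" "b = - u * p"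
proof -
  \<comment> \<open>For a = u q and b = - u p, these expressions equal \<open>var_x ^ k * u\<close>
    and \<open>var_y ^ l * u\<close>; so u is sought as the quotient of s by
    \<open>var_x ^ k\<close>.\<close>
  define s t where "s = \<beta> * a - \<alpha> * b" and "t = \<delta> * a - \<gamma> * b"
  have bq: "b * q = - (a * p)" using syz by (simp add: add_eq_0_iff2)
  have xa: "var_x ^ k * a = s * q"
  proof -
    have "var_x ^ k * a = \<alpha> * (a * p) + \<beta> * a * q" by (simp add: x algebra_simps)
    also have "a * p = - (b * q)" using bq by simp
    finally show ?thesis by (simp add: s_def algebra_simps)
  qed
  have xb: "var_x ^ k * b = - s * p"
  proof -
    have "var_x ^ k * b = \<alpha> * b * p + \<beta> * (b * q)" by (simp add: x algebra_simps)
    then show ?thesis by (simp add: bq s_def algebra_simps)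
  qed
  have ya: "var_y ^ l * a = t * q"
  proof -
    have "var_y ^ l * a = \<gamma> * (a * p) + \<delta> * a * q" by (simp add: y algebra_simps)
    also have "a * p = - (b * q)" using bq by simp
    finally show ?thesis by (simp add: t_def algebra_simps)
  qed
  have yb: "var_y ^ l * b = - t * p"
  proof -
    have "var_y ^ l * b = \<gamma> * b * p + \<delta> * (b * q)" by (simp add: y algebra_simps)
    then show ?thesis by (simp add: bq t_def algebra_simps)
  qed
  have "(var_y ^ l * s) * q = (var_x ^ k * t) * q"
    using xa ya by (metis mult.assoc mult.left_commute)
  moreover have "(var_y ^ l * s) * p = (var_x ^ k * t) * p"
  proof -
    have "(var_y ^ l * s) * p = - (var_y ^ l * (var_x ^ k * b))" by (simp add: xb mult.assoc)
    also have "\<dots> = - (var_x ^ k * (var_y ^ l * b))" by (simp add: mult.left_commute)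
    also have "\<dots> = (var_x ^ k * t) * p" by (simp add: yb mult.assoc)
    finally show ?thesis .
  qed
  moreover have "p \<noteq> 0 \<or> q \<noteq> 0"
  proof (rule ccontr)
    assume "\<not> (p \<noteq> 0 \<or> q \<noteq> 0)"
    then have "var_x ^ k = 0" using x by simp
    then show False using var_power_nonzero(1)[of k] by blast
  qed
  ultimately have st: "var_y ^ l * s = var_x ^ k * t" by (metis mult_right_cancel)
  have "convergent_series s"
    unfolding s_def by (intro convergent_series_diff convergent_series_mult conv)
  \<comment> \<open>Multiplication by a power of y leaves the exponents of x alone, so
    \<open>var_x ^ k\<close> divides s already.\<close>
  moreover have "coef s i j = 0" if "i < k" for i j
  proof -
    have "coef s i j = coef (var_y ^ l * s) i (j + l)" by (simp add: coef_var_y_power_mult)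
    also have "\<dots> = 0" using that by (simp add: st coef_var_x_power_mult)
    finally show ?thesis .
  qed
  ultimately obtain u where u: "convergent_series u" "s = var_x ^ k * u"
    by (rule divide_var_x_power)
  have "var_x ^ k * a = var_x ^ k * (u * q)" "var_x ^ k * b = var_x ^ k * (- u * p)"
    using xa xb by (simp_all add: u(2) mult.assoc)
  then have "a = u * q" "b = - u * p"
    unfolding mult_left_cancel[OF var_power_nonzero(1)] by simp_all
  then show ?thesis using that u(1) by blast
qed

lemma isolated_singularityD:
  assumes "isolated_singularity f"
  shows "convergent_series f" "coef f 0 0 = 0" "finite_quot_dim (jacobian_ideal f)"
  using assms by (auto simp: isolated_singularity_def)

lemma presentation_tjurina_exists:
  assumes f: "isolated_singularity f"
  shows "\<exists>n m A g. presentation conv_ring (ideal_module conv_ring (tjurina_ideal f)) n m A g"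
proof -
  note conv = isolated_singularityD(1)[OF f]
  note J = ideal_jacobian[OF conv]
  let ?p = "partial_x f" and ?q = "partial_y f"
  note pq = convergent_series_partial_x[OF conv] convergent_series_partial_y[OF conv]
  obtain N where N: "cps.reldim (jacobian_ideal f) {F. convergent_series F} N"
    by (rule finite_quot_dimD[OF J isolated_singularityD(3)[OF f]])
  obtain k where "var_x ^ k \<in> jacobian_ideal f"
    by (rule power_mem_of_reldim[OF J N convergent_series_var_x]) (auto simp: var_x_def)
  then obtain \<alpha> \<beta> where x: "var_x ^ k = \<alpha> * ?p + \<beta> * ?q" "convergent_series \<alpha>" "convergent_series \<beta>"
    unfolding jacobian_ideal_eq[OF conv] by blast
  obtain l where "var_y ^ l \<in> jacobian_ideal f"
    by (rule power_mem_of_reldim[OF J N convergent_series_var_y]) (auto simp: var_y_def)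
  then obtain \<gamma> \<delta> where y: "var_y ^ l = \<gamma> * ?p + \<delta> * ?q"
    unfolding jacobian_ideal_eq[OF conv] by blast
  have "ann_ideal f \<subseteq> {F. convergent_series F}" by (auto simp: ann_ideal_def)
  from cps.reldim_split[OF N ideal_subspace[OF J] ideal_subspace[OF ideal_ann[OF conv]]
      jacobian_subset_ann[OF conv] this]
  obtain n where n: "cps.reldim (jacobian_ideal f) (ann_ideal f) n" by metis
  obtain b where b: "\<forall>l<n. b l \<in> ann_ideal f"
    "ann_ideal f = {j + (\<Sum>l<n. cst (c l) * b l) | j c. j \<in> jacobian_ideal f}"
    by (rule cps.reldim_basis[OF n ideal_subspace[OF J]])
  have "\<forall>l. \<exists>uv. l < n \<longrightarrow> convergent_series (fst uv) \<and> convergent_series (snd uv) \<and>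
      b l * f = fst uv * ?p + snd uv * ?q"
  proof
    fix l
    have "\<exists>u v. convergent_series u \<and> convergent_series v \<and> b l * f = u * ?p + v * ?q" if "l < n"
    proof -
      have "b l * f \<in> jacobian_ideal f" using b(1) that by (simp add: ann_ideal_def)
      then show ?thesis unfolding jacobian_ideal_eq[OF conv] by blast
    qed
    then show "\<exists>uv. l < n \<longrightarrow> convergent_series (fst uv) \<and> convergent_series (snd uv) \<and>
      b l * f = fst uv * ?p + snd uv * ?q" by (metis fst_conv snd_conv)
  qed
  from choice[OF this] obtain uv where uv: "\<And>l. l < n \<Longrightarrow> convergent_series (fst (uv l)) \<and>
    convergent_series (snd (uv l)) \<and> b l * f = fst (uv l) * ?p + snd (uv l) * ?q" by blast
  \<comment> \<open>The first n columns realise the elements \<open>b c\<close>, which span Ann(f)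
    modulo J_f, as third entries up to sign. The next two are the Koszul relations of f with f_x and
    f_y and supply the third entries in J_f. The last one is the Koszul relation of f_x and f_y,
    which generates the syzygies with third entry 0.\<close>
  define col where "col = (\<lambda>c. if c < n then (fst (uv c), snd (uv c), - b c)
    else if c = n then (f, 0, - ?p) else if c = Suc n then (0, f, - ?q) else (?q, - ?p, 0))"
  define A where "A = (\<lambda>(i::nat) c. if i = 0 then fst (col c) else if i = 1 then fst (snd (col c)) else snd (snd (col c)))"
  have A: "convergent_series (A i c)" for i c
    using uv[of c] b(1) pq conv
    by (auto simp: A_def col_def ann_ideal_def intro: convergent_series_0 convergent_series_uminus)
  have cols: "(\<lambda>i. A i c) \<in> syzygies 3 (tjurina_gens f)" for c
  proof -
    have "A 0 c * ?p + A 1 c * ?q + A 2 c * f = 0"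
      using uv[of c] by (auto simp: A_def col_def algebra_simps)
    then show ?thesis
      using A by (simp add: syzygies_def sum_lessThan_3 tjurina_gens_def)
  qed
  have syz: "\<exists>w. (\<forall>c<n + 3. convergent_series (w c)) \<and> (\<forall>i<3. \<sigma> i = (\<Sum>c<n + 3. A i c * w c))"
    if \<sigma>: "\<sigma> \<in> syzygies 3 (tjurina_gens f)" for \<sigma>
  proof -
    have \<sigma>conv: "convergent_series (\<sigma> 0)" "convergent_series (\<sigma> 1)" "convergent_series (\<sigma> 2)"
      and \<sigma>0: "\<sigma> 0 * ?p + \<sigma> 1 * ?q + \<sigma> 2 * f = 0"
      using \<sigma> by (simp_all add: syzygies_def sum_lessThan_3 tjurina_gens_def)
    have "\<sigma> 2 * f = (\<sigma> 0 * ?p + \<sigma> 1 * ?q + \<sigma> 2 * f) + (- \<sigma> 0) * ?p + (- \<sigma> 1) * ?q"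
      by simp
    then have "\<sigma> 2 * f = (- \<sigma> 0) * ?p + (- \<sigma> 1) * ?q" unfolding \<sigma>0 by simp
    then have "\<sigma> 2 * f \<in> jacobian_ideal f"
      unfolding jacobian_ideal_eq[OF conv] using \<sigma>conv convergent_series_uminus by blast
    then have "\<sigma> 2 \<in> ann_ideal f" using \<sigma>conv by (simp add: ann_ideal_def)
    then obtain j c where jc: "\<sigma> 2 = j + (\<Sum>l<n. cst (c l) * b l)" "j \<in> jacobian_ideal f"
      using b(2) by blast
    then obtain r s where rs: "j = r * ?p + s * ?q" "convergent_series r" "convergent_series s"
      unfolding jacobian_ideal_eq[OF conv] by blast
    \<comment> \<open>The signs match the third entries of the first n + 2 columns, so this
      combination has third entry \<open>\<sigma> 2\<close>. Subtracting it leaves a syzygy of the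
      two partial derivatives alone.\<close>
    define w where "w = (\<lambda>l. if l < n then - cst (c l) else if l = n then - r else - s)"
    have w: "convergent_series (w l)" for l
      using rs by (auto simp: w_def intro: convergent_series_uminus convergent_series_const)
    define \<sigma>' where "\<sigma>' = (\<lambda>i. \<sigma> i - (\<Sum>c<n + 2. A i c * w c))"
    have \<sigma>'conv: "convergent_series (\<sigma>' 0)" "convergent_series (\<sigma>' 1)"
      using A w \<sigma>conv unfolding \<sigma>'_def
      by (auto intro!: convergent_series_diff convergent_series_sum convergent_series_add
          convergent_series_mult)
    have "(\<Sum>c<n + 2. A 2 c * w c) = (\<Sum>l<n. cst (c l) * b l) + ?p * r + ?q * s"
      by (simp add: eval_nat_numeral A_def col_def w_def mult.commute flip: fps_const_neg)
    then have \<sigma>'2: "\<sigma>' 2 = 0" by (simp add: \<sigma>'_def jc(1) rs(1) mult.commute)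
    have comb: "(\<Sum>c<n + 2. A 0 c * w c) * ?p + (\<Sum>c<n + 2. A 1 c * w c) * ?q + (\<Sum>c<n + 2. A 2 c * w c) * f = 0"
    proof -
      have "(\<Sum>c<n + 2. A 0 c * w c) * ?p + (\<Sum>c<n + 2. A 1 c * w c) * ?q + (\<Sum>c<n + 2. A 2 c * w c) * f
          = (\<Sum>c<n + 2. w c * (A 0 c * ?p + A 1 c * ?q + A 2 c * f))"
        unfolding sum_distrib_right sum.distrib[symmetric] by (intro sum.cong refl) (simp add: algebra_simps)
      also have "\<dots> = 0"
        using cols by (intro sum.neutral) (simp add: syzygies_def sum_lessThan_3 tjurina_gens_def)
      finally show ?thesis .
    qed
    have "\<sigma>' 0 * ?p + \<sigma>' 1 * ?q + \<sigma>' 2 * f = 0"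
    proof -
      have "\<sigma>' 0 * ?p + \<sigma>' 1 * ?q + \<sigma>' 2 * f = (\<sigma> 0 * ?p + \<sigma> 1 * ?q + \<sigma> 2 * f)
        - ((\<Sum>c<n + 2. A 0 c * w c) * ?p + (\<Sum>c<n + 2. A 1 c * w c) * ?q + (\<Sum>c<n + 2. A 2 c * w c) * f)"
        unfolding \<sigma>'_def left_diff_distrib by simp
      then show ?thesis unfolding \<sigma>0 comb by simp
    qed
    then have "\<sigma>' 0 * ?p + \<sigma>' 1 * ?q = 0" by (simp add: \<sigma>'2)
    then obtain u where u: "convergent_series u" "\<sigma>' 0 = u * ?q" "\<sigma>' 1 = - u * ?p"
      by (rule koszul_syzygy[OF x(2,3) \<sigma>'conv x(1) y])
    define w' where "w' = w(Suc (Suc n) := u)"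
    have "\<sigma> i = (\<Sum>c<n + 3. A i c * w' c)" if "i < 3" for i
    proof -
      have "(\<Sum>c<n + 2. A i c * w' c) = (\<Sum>c<n + 2. A i c * w c)"
        by (intro sum.cong) (auto simp: w'_def)
      then have "(\<Sum>c<n + 3. A i c * w' c) = (\<Sum>c<n + 2. A i c * w c) + A i (Suc (Suc n)) * u"
        by (simp add: eval_nat_numeral w'_def)
      also have "A i (Suc (Suc n)) * u = \<sigma>' i"
      proof -
        have "i = 0 \<or> i = 1 \<or> i = 2" using that by auto
        then show ?thesis using u(2,3) \<sigma>'2 by (auto simp: A_def col_def mult.commute)
      qed
      finally show ?thesis by (simp add: \<sigma>'_def)
    qed
    moreover have "\<forall>c<n + 3. convergent_series (w' c)" using w u(1) by (simp add: w'_def)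
    ultimately show ?thesis by blast
  qed
  have "tjurina_gens f i \<in> tjurina_ideal f" for i
    using tjurina_gens_mem[OF conv] by (simp add: tjurina_gens_def)
  then have "presentation conv_ring (ideal_module conv_ring (tjurina_ideal f)) 3 (n + 3) A (tjurina_gens f)"
    unfolding presentation_conv_ring_iff[OF ideal_tjurina[OF conv]]
    using A cols syz by (auto simp: tjurina_ideal_eq[OF conv])
  then show ?thesis by blast
qed

section \<open>Derivations preserving the Tjurina ideal\<close>

lemma partial_power:
  "partial_x (z ^ Suc j) = of_nat (Suc j) * z ^ j * partial_x z"
  "partial_y (z ^ Suc j) = of_nat (Suc j) * z ^ j * partial_y z"
proof -
  show "partial_x (z ^ Suc j) = of_nat (Suc j) * z ^ j * partial_x z"
  proof (induction j)
    case (Suc j)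
    have "partial_x (z ^ Suc (Suc j)) = partial_x z * z ^ Suc j + z * partial_x (z ^ Suc j)"
      using partial_mult(1)[of z "z ^ Suc j"] by simp
    then show ?case unfolding Suc by (simp add: algebra_simps)
  qed simp
  show "partial_y (z ^ Suc j) = of_nat (Suc j) * z ^ j * partial_y z"
  proof (induction j)
    case (Suc j)
    have "partial_y (z ^ Suc (Suc j)) = partial_y z * z ^ Suc j + z * partial_y (z ^ Suc j)"
      using partial_mult(2)[of z "z ^ Suc j"] by simp
    then show ?case unfolding Suc by (simp add: algebra_simps)
  qed simp
qed

lemma coef_of_nat: "coef (of_nat n) 0 0 = of_nat n"
  by (induction n) auto

text \<open>Applied to \<open>z ^ Suc j\<close>, a derivation \<open>a \<partial>\<^sub>x + b \<partial>\<^sub>y\<close> preserving \<open>I\<close> lowers the exponent.\<close>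

lemma one_mem_of_derivation_stable:
  assumes I: "ideal I conv_ring"
    and stable: "\<And>F. F \<in> I \<Longrightarrow> a * partial_x F + b * partial_y F \<in> I"
    and conv: "convergent_series a" "convergent_series b" "convergent_series z"
    and unit: "coef (a * partial_x z + b * partial_y z) 0 0 \<noteq> 0"
    and k: "z ^ k \<in> I"
  shows "1 \<in> I"
  using k
proof (induction k)
  case (Suc k)
  \<comment> \<open>The derivation sends \<open>z ^ Suc k\<close> to \<open>d * z ^ k\<close>, and d
    is a unit because the integer factor is invertible in characteristic 0.\<close>
  define d where "d = of_nat (Suc k) * (a * partial_x z + b * partial_y z)"
  have "convergent_series d"
    unfolding d_def using conv
    by (intro convergent_series_mult convergent_series_of_nat convergent_series_add
        convergent_series_partial_x convergent_series_partial_y)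
  moreover have "coef d 0 0 \<noteq> 0"
    unfolding d_def coef_0_mult coef_of_nat using unit by (simp del: of_nat_Suc)
  ultimately obtain e where e: "convergent_series e" "d * e = 1"
    by (rule convergent_series_inverse)
  have "a * partial_x (z ^ Suc k) + b * partial_y (z ^ Suc k) = d * z ^ k"
    unfolding partial_power d_def by (simp add: algebra_simps)
  then have "d * z ^ k \<in> I" using stable[OF Suc.prems] by simp
  then have "e * (d * z ^ k) \<in> I" by (rule ideal_conv_mult[OF I e(1)])
  moreover have "e * (d * z ^ k) = z ^ k" using e(2) by (metis mult.assoc mult.commute mult_1_left)
  ultimately show ?case using Suc.IH by simp
qed simp

text \<open>A partial derivative that does not vanish at the origin would be a unit, so J_f would be
  the whole ring and contain f.\<close>

lemma tjurina_subset_nonunits: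
  assumes f: "isolated_singularity f" "\<not> quasi_homogeneous f" and F: "F \<in> tjurina_ideal f"
  shows "coef F 0 0 = 0"
proof -
  note conv = isolated_singularityD(1)[OF f(1)]
  note J = ideal_jacobian[OF conv]
  have "1 \<notin> jacobian_ideal f"
  proof
    assume "1 \<in> jacobian_ideal f"
    then have "f \<in> jacobian_ideal f" using ideal_conv_mult[OF J conv, of 1] by simp
    then show False using f(2) by (simp add: quasi_homogeneous_def)
  qed
  then have 0: "coef (partial_x f) 0 0 = 0" "coef (partial_y f) 0 0 = 0"
    using ideal_conv_unit[OF J] jacobian_gens_mem[OF conv] by blast+
  obtain a where "F = (\<Sum>l<3. a l * tjurina_gens f l)"
    using F unfolding tjurina_ideal_eq[OF conv] by blast
  then show ?thesis
    using 0 isolated_singularityD(2)[OF f(1)] by (simp add: sum_lessThan_3 tjurina_gens_def)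
qed

text \<open>The syzygy says that the derivation D given by a and b maps f to - c f. Differentiating
  this equation and commuting the partial derivatives puts D f_x and D f_y into the ideal as well;
  the Leibniz rule passes from the generators to all elements.\<close>

lemma derivation_stable_tjurina:
  assumes conv: "convergent_series f" "convergent_series a" "convergent_series b" "convergent_series c"
    and syz: "a * partial_x f + b * partial_y f + c * f = 0" and F: "F \<in> tjurina_ideal f"
  shows "a * partial_x F + b * partial_y F \<in> tjurina_ideal f"
proof -
  define D where "D = (\<lambda>F. a * partial_x F + b * partial_y F)"
  note I = ideal_tjurina[OF conv(1)]
  note gens = tjurina_gens_mem[OF conv(1)]
  note conv_partial = convergent_series_partial_x convergent_series_partial_y
  have D_mult: "D (F * G) = D F * G + F * D G" and D_add: "D (F + G) = D F + D G" for F G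
    by (simp_all add: D_def partial_mult partial_add algebra_simps)
  have conv_D: "convergent_series (D F)" if "convergent_series F" for F
    unfolding D_def using conv that by (intro convergent_series_add convergent_series_mult conv_partial)
  have syz': "a * partial_x f + b * partial_y f = - (c * f)"
    using syz by (simp add: add_eq_0_iff2)
  have Df: "D f = - c * f" using syz' by (simp add: D_def)
  have "D (partial_x f) = - c * partial_x f - partial_x c * f
      - partial_x a * partial_x f - partial_x b * partial_y f"
  proof -
    have "partial_x (a * partial_x f + b * partial_y f) = partial_x (- (c * f))" using syz' by simp
    then show ?thesis
      unfolding D_def by (simp add: partial_mult partial_add partial_uminus partial_commute algebra_simps)
  qed
  moreover have "D (partial_y f) = - c * partial_y f - partial_y c * f
      - partial_y a * partial_x f - partial_y b * partial_y f"
  proof -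
    have "partial_y (a * partial_x f + b * partial_y f) = partial_y (- (c * f))" using syz' by simp
    then show ?thesis
      unfolding D_def by (simp add: partial_mult partial_add partial_uminus partial_commute algebra_simps)
  qed
  ultimately have D_gens: "D f \<in> tjurina_ideal f" "D (partial_x f) \<in> tjurina_ideal f"
    "D (partial_y f) \<in> tjurina_ideal f"
    unfolding Df using conv gens
    by (auto intro!: ideal_conv_diff[OF I] ideal_conv_mult[OF I] ideal_conv_uminus[OF I] conv_partial)
  obtain w where w: "F = (\<Sum>l<3. w l * tjurina_gens f l)" "\<forall>l<3. convergent_series (w l)"
    using F unfolding tjurina_ideal_eq[OF conv(1)] by blast
  have "F = w 0 * partial_x f + w 1 * partial_y f + w 2 * f"
    using w(1) by (simp add: sum_lessThan_3 tjurina_gens_def)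
  moreover have "D (w l * G) \<in> tjurina_ideal f"
    if "l < 3" "G \<in> tjurina_ideal f" "D G \<in> tjurina_ideal f" for l G
    unfolding D_mult using w(2) that
    by (intro ideal_conv_add[OF I] ideal_conv_mult[OF I] conv_D) auto
  ultimately have "D F \<in> tjurina_ideal f"
    using D_gens gens by (auto simp: D_add intro!: ideal_conv_add[OF I])
  then show ?thesis by (simp add: D_def)
qed

text \<open>A syzygy with a unit entry would be a non-vanishing vector field preserving \<open>tjurina_ideal f\<close>,
  or would show that \<open>f\<close> is quasi-homogeneous.\<close>

lemma syzygy_nonunit:
  assumes f: "isolated_singularity f" "\<not> quasi_homogeneous f"
    and \<sigma>: "\<sigma> \<in> syzygies 3 (tjurina_gens f)" and l: "l < 3"
  shows "coef (\<sigma> l) 0 0 = 0"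
proof (rule ccontr)
  assume unit: "coef (\<sigma> l) 0 0 \<noteq> 0"
  note conv = isolated_singularityD(1)[OF f(1)]
  note J = ideal_jacobian[OF conv] and I = ideal_tjurina[OF conv]
  have \<sigma>conv: "convergent_series (\<sigma> 0)" "convergent_series (\<sigma> 1)" "convergent_series (\<sigma> 2)"
    and \<sigma>0: "\<sigma> 0 * partial_x f + \<sigma> 1 * partial_y f + \<sigma> 2 * f = 0"
    using \<sigma> by (simp_all add: syzygies_def sum_lessThan_3 tjurina_gens_def)
  have one: "1 \<notin> tjurina_ideal f" using tjurina_subset_nonunits[OF f, of 1] by auto
  obtain N where N: "cps.reldim (jacobian_ideal f) {F. convergent_series F} N"
    by (rule finite_quot_dimD[OF J isolated_singularityD(3)[OF f(1)]])
  \<comment> \<open>To be applied to the coordinates x and y, on which the derivation takes the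
    values \<open>\<sigma> 0\<close> and \<open>\<sigma> 1\<close>.\<close>
  have no_unit: False
    if z: "convergent_series z" "coef z 0 0 = 0" "coef (\<sigma> 0 * partial_x z + \<sigma> 1 * partial_y z) 0 0 \<noteq> 0" for z
  proof -
    obtain k where "z ^ k \<in> jacobian_ideal f" by (rule power_mem_of_reldim[OF J N z(1,2)])
    then have "z ^ k \<in> tjurina_ideal f" using jacobian_subset_tjurina[OF conv] by blast
    then have "1 \<in> tjurina_ideal f"
      using one_mem_of_derivation_stable[OF I _ \<sigma>conv(1,2) z(1,3)]
        derivation_stable_tjurina[OF conv \<sigma>conv \<sigma>0] by blast
    then show False using one by blast
  qed
  have "l = 0 \<or> l = 1 \<or> l = 2" using l by auto
  then show False
  proof (elim disjE)
    assume "l = 0"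
    then show False using no_unit[of var_x] unit
      by (simp add: partial_var convergent_series_var_x) (simp add: var_x_def)
  next
    assume "l = 1"
    then show False using no_unit[of var_y] unit
      by (simp add: partial_var convergent_series_var_y) (simp add: var_y_def)
  next
    assume "l = 2"
    then obtain e where e: "convergent_series e" "\<sigma> 2 * e = 1"
      using convergent_series_inverse[OF \<sigma>conv(3)] unit by blast
    have "\<sigma> 2 * f = - (\<sigma> 0 * partial_x f + \<sigma> 1 * partial_y f)"
      using \<sigma>0 by (simp add: add_eq_0_iff)
    then have "e * (\<sigma> 2 * f) \<in> jacobian_ideal f"
      using \<sigma>conv jacobian_gens_mem[OF conv] e(1)
      by (auto intro!: ideal_conv_mult[OF J] ideal_conv_uminus[OF J] ideal_conv_add[OF J] simp del: minus_add_distrib)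
    moreover have "e * (\<sigma> 2 * f) = f" using e(2) by (metis mult.assoc mult.commute mult_1_left)
    ultimately show False using f(2) by (simp add: quasi_homogeneous_def)
  qed
qed

section \<open>Bounds for the Fitting ideal and the dimension count\<close>

lemma max_ideal_eq: "max_ideal = {F. convergent_series F \<and> coef F 0 0 = 0}"
proof (rule antisym)
  have "ideal {F. convergent_series F \<and> coef F 0 0 = 0} conv_ring"
    unfolding ideal_conv_iff
    by (auto intro: convergent_series_0 convergent_series_add convergent_series_mult)
  then show "max_ideal \<subseteq> {F. convergent_series F \<and> coef F 0 0 = 0}"
    unfolding max_ideal_def
    by (rule conv.genideal_minimal)
      (auto simp: convergent_series_var_x convergent_series_var_y, simp_all add: var_x_def var_y_def)
  have vars: "{var_x, var_y} \<subseteq> carrier conv_ring"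
    by (simp add: convergent_series_var_x convergent_series_var_y)
  note m = conv.genideal_ideal[OF vars, folded max_ideal_def]
  show "{F. convergent_series F \<and> coef F 0 0 = 0} \<subseteq> max_ideal"
  proof clarify
    fix F assume "convergent_series F" "coef F 0 0 = 0"
    then obtain G H where "convergent_series G" "convergent_series H" "F = G * var_x + H * var_y"
      by (rule max_ideal_decomposition)
    then show "F \<in> max_ideal"
      using conv.genideal_self[OF vars, folded max_ideal_def]
      by (auto intro!: ideal_conv_add[OF m] ideal_conv_mult[OF m])
  qed
qed

text \<open>P and Q exist because g and \<open>tjurina_gens f\<close> generate the same ideal. An
  element a of Ann(f) is, up to sign, the last entry of a syzygy of the triple, which gives the
  lower bound; the upper bound rests on \<open>syzygy_nonunit\<close>.\<close>

lemma fitting_ideal_bounds: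
  assumes f: "isolated_singularity f" "\<not> quasi_homogeneous f"
    and pres: "presentation conv_ring (ideal_module conv_ring (tjurina_ideal f)) n m A g"
    and I: "I = Idl\<^bsub>conv_ring\<^esub> (minors conv_ring n m A (n - 2))"
  shows "ideal I conv_ring" "ann_ideal f \<subseteq> I" "I \<subseteq> max_ideal"
proof -
  note conv = isolated_singularityD(1)[OF f(1)]
  let ?h = "tjurina_gens f"
  note pres' = pres[unfolded presentation_conv_ring_iff[OF ideal_tjurina[OF conv]]]
  have A: "\<And>i j. i < n \<Longrightarrow> j < m \<Longrightarrow> convergent_series (A i j)" and g: "\<And>i. i < n \<Longrightarrow> g i \<in> tjurina_ideal f"
    and cols: "\<And>c. c < m \<Longrightarrow> (\<lambda>i. A i c) \<in> syzygies n g"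
    and syz: "\<And>v. v \<in> syzygies n g \<Longrightarrow>
      \<exists>w. (\<forall>c<m. convergent_series (w c)) \<and> (\<forall>i<n. v i = (\<Sum>c<m. A i c * w c))"
    and gen: "\<And>a. a \<in> tjurina_ideal f \<Longrightarrow> \<exists>v. (\<forall>i<n. convergent_series (v i)) \<and> a = (\<Sum>i<n. v i * g i)"
    using pres' by blast+
  have minors: "minors conv_ring n m A (n - 2) = {det (mat (n - 2) (n - 2) (\<lambda>(i, j). A (r i) (c j))) | r c.
    r \<in> {..<n - 2} \<rightarrow> {..<n} \<and> strict_mono_on {..<n - 2} r \<and>
    c \<in> {..<n - 2} \<rightarrow> {..<m} \<and> strict_mono_on {..<n - 2} c}"
    by (rule minors_conv_ring) (rule A)
  have sub: "minors conv_ring n m A (n - 2) \<subseteq> carrier conv_ring"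
    by (rule minors_conv_ring_subset) (rule A)
  show ideal: "ideal I conv_ring" unfolding I by (rule conv.genideal_ideal[OF sub])
  have "\<forall>l. \<exists>v. (\<forall>i<n. convergent_series (v i)) \<and> ?h l = (\<Sum>i<n. v i * g i)"
    using gen tjurina_gens_mem[OF conv] by (simp add: tjurina_gens_def)
  from choice[OF this] obtain P' where P': "\<And>l. (\<forall>i<n. convergent_series (P' l i)) \<and> ?h l = (\<Sum>i<n. P' l i * g i)"
    by blast
  define P where "P = (\<lambda>i l. P' l i)"
  have P: "\<And>i l. i < n \<Longrightarrow> l < 3 \<Longrightarrow> convergent_series (P i l)"
    and h: "\<And>l. l < 3 \<Longrightarrow> ?h l = (\<Sum>i<n. P i l * g i)"
    using P' by (auto simp: P_def)
  have "\<forall>i. \<exists>q. i < n \<longrightarrow> (\<forall>l<3. convergent_series (q l)) \<and> g i = (\<Sum>l<3. q l * ?h l)"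
    using g unfolding tjurina_ideal_eq[OF conv] by blast
  from choice[OF this] obtain Q' where
    Q': "\<And>i. i < n \<Longrightarrow> (\<forall>l<3. convergent_series (Q' i l)) \<and> g i = (\<Sum>l<3. Q' i l * ?h l)"
    by blast
  define Q where "Q = (\<lambda>l i. Q' i l)"
  have Q: "\<And>i l. i < n \<Longrightarrow> l < 3 \<Longrightarrow> convergent_series (Q l i)"
    and gQ: "\<And>i. i < n \<Longrightarrow> g i = (\<Sum>l<3. Q l i * ?h l)"
    using Q' by (auto simp: Q_def)
  have "minors_in I n ((\<lambda>c i. A i c) ` {..<m}) (n - 2)"
  proof (rule minors_in_sorted[OF ideal])
    fix r c assume "r \<in> {..<n - 2} \<rightarrow> {..<n}" "strict_mono_on {..<n - 2} r"
      "c \<in> {..<n - 2} \<rightarrow> {..<m}" "strict_mono_on {..<n - 2} c"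
    then have "det (mat (n - 2) (n - 2) (\<lambda>(i, j). A (r i) (c j))) \<in> minors conv_ring n m A (n - 2)"
      unfolding minors by blast
    then show "det (mat (n - 2) (n - 2) (\<lambda>(i, j). A (r i) (c j))) \<in> I"
      unfolding I using conv.genideal_self[OF sub] by blast
  qed
  then have "minors_in I n (syzygies n g) (n - 2)"
    by (rule minors_in_span[OF ideal]) (use syz in \<open>simp add: mult.commute\<close>)
  \<comment> \<open>The number 3 is that of the generators \<open>tjurina_gens f\<close>. Truncated
    subtraction makes both sizes equal also for n < 2.\<close>
  then have S: "minors_in I n (syzygies n g) (Suc n - 3)" by (simp add: eval_nat_numeral)
  show "ann_ideal f \<subseteq> I"
  proof
    fix a assume "a \<in> ann_ideal f"
    then obtain u v where a: "convergent_series a" "convergent_series u" "convergent_series v"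
      "a * f = u * partial_x f + v * partial_y f"
      unfolding ann_ideal_def jacobian_ideal_eq[OF conv] by auto
    define \<sigma> where "\<sigma> = (\<lambda>l::nat. if l = 0 then u else if l = 1 then v else - a)"
    have "\<sigma> \<in> syzygies 3 ?h"
      using a by (auto simp: syzygies_def sum_lessThan_3 tjurina_gens_def \<sigma>_def intro: convergent_series_uminus)
    then have "\<sigma> 2 \<in> I"
      by (intro syzygy_entry_in_minors[OF ideal S P Q h gQ]) auto
    then show "a \<in> I" using ideal_conv_uminus[OF ideal, of "- a"] by (simp add: \<sigma>_def)
  qed
  have m_ideal: "ideal max_ideal conv_ring"
    unfolding max_ideal_def
    by (rule conv.genideal_ideal) (simp add: convergent_series_var_x convergent_series_var_y)
  have "minors conv_ring n m A (n - 2) \<subseteq> max_ideal"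
  proof
    fix x assume x: "x \<in> minors conv_ring n m A (n - 2)"
    then obtain r c where rc: "x = det (mat (n - 2) (n - 2) (\<lambda>(i, j). A (r i) (c j)))"
      "r \<in> {..<n - 2} \<rightarrow> {..<n}" "c \<in> {..<n - 2} \<rightarrow> {..<m}"
      unfolding minors by blast
    have "coef x 0 0 = 0"
      unfolding rc(1)
      by (rule minor_at_origin[OF cols P Q h gQ _ _ rc(2,3)])
        (use syzygy_nonunit[OF f] in auto)
    then show "x \<in> max_ideal" using x sub by (auto simp: max_ideal_eq)
  qed
  then show "I \<subseteq> max_ideal" unfolding I by (rule conv.genideal_minimal[OF m_ideal])
qed

theorem proposition1p2:
  fixes f :: "complex fps fps"
  assumes "isolated_singularity f"
    and "\<not> quasi_homogeneous f"
  shows "(ann_ideal f \<subseteq> fitt2 f \<and> fitt2 f \<subseteq> max_ideal) \<and>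
         (finite_quot_dim (fitt2 f) \<and>
          int (milnor_number f) - int (tjurina_number f) \<ge> int (quot_dim (fitt2 f))) \<and>
         (int (milnor_number f) - int (tjurina_number f) = 1 \<longrightarrow>
          ann_ideal f = fitt2 f \<and> fitt2 f = max_ideal \<and>
          int (milnor_number f) - int (tjurina_number f) = int (quot_dim (fitt2 f)))"
proof -
  note conv = isolated_singularityD(1)[OF assms(1)]
  note J = ideal_jacobian[OF conv] and I = ideal_tjurina[OF conv] and An = ideal_ann[OF conv]
  let ?R = "{F. convergent_series F}"
  let ?M = "ideal_module conv_ring (tjurina_ideal f)"
  have "\<exists>Fit n m A g. presentation conv_ring ?M n m A g \<and> Fit = Idl\<^bsub>conv_ring\<^esub> (minors conv_ring n m A (n - 2))"
    using presentation_tjurina_exists[OF assms(1)] by blast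
  \<comment> \<open>Nothing is known about the chosen presentation except that it is one.\<close>
  from someI_ex[OF this] obtain n m A g where "presentation conv_ring ?M n m A g"
    "fitt2 f = Idl\<^bsub>conv_ring\<^esub> (minors conv_ring n m A (n - 2))"
    unfolding fitt2_def fitting_ideal_def by blast
  note fit = fitting_ideal_bounds[OF assms this]
  have m: "ideal max_ideal conv_ring"
    unfolding max_ideal_def
    by (rule conv.genideal_ideal) (simp add: convergent_series_var_x convergent_series_var_y)
  have one_m: "1 \<notin> max_ideal" by (simp add: max_ideal_eq)
  then have one: "1 \<notin> fitt2 f" "1 \<notin> ann_ideal f" using fit(2,3) by blast+
  have one_I: "1 \<notin> tjurina_ideal f" using tjurina_subset_nonunits[OF assms, of 1] by auto
  then have one_J: "1 \<notin> jacobian_ideal f" using jacobian_subset_tjurina[OF conv] by blast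
  have sub: "I \<subseteq> ?R" if "ideal I conv_ring" for I
    using ideal_conv_convergent[OF that] by blast
  obtain N where N: "cps.reldim (jacobian_ideal f) ?R N"
    by (rule finite_quot_dimD[OF J isolated_singularityD(3)[OF assms(1)]])
  obtain a b where ab: "cps.reldim (jacobian_ideal f) (tjurina_ideal f) a" "cps.reldim (tjurina_ideal f) ?R b"
    by (rule cps.reldim_split[OF N ideal_subspace[OF J] ideal_subspace[OF I]
          jacobian_subset_tjurina[OF conv] sub[OF I]])
  obtain c d where d: "cps.reldim (jacobian_ideal f) (ann_ideal f) c" "cps.reldim (ann_ideal f) ?R d"
    by (rule cps.reldim_split[OF N ideal_subspace[OF J] ideal_subspace[OF An]
          jacobian_subset_ann[OF conv] sub[OF An]])
  have "cps.reldim (jacobian_ideal f) (tjurina_ideal f) d"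
    unfolding tjurina_ideal_eq_mult_add[OF conv]
    by (rule cps.reldim_image[OF d(2) convergent_subspace sub[OF An] order_refl ideal_subspace[OF J]
          _ _ ideal_subspace[OF An]])
      (auto simp: ann_ideal_def distrib_right mult.assoc)
  then have "cps.reldim (jacobian_ideal f) ?R (d + b)"
    by (rule cps.reldim_trans[OF ab(2)])
  then have "milnor_number f = d + b"
    unfolding milnor_number_def by (rule reldim_imp_quot_dim(2)[OF J one_J])
  moreover have "tjurina_number f = b"
    unfolding tjurina_number_def by (rule reldim_imp_quot_dim(2)[OF I one_I ab(2)])
  ultimately have diff: "int (milnor_number f) - int (tjurina_number f) = int d" by simp
  \<comment> \<open>Here s is the codimension of the Fitting ideal, so the inequality amounts to s
    being at most r + s.\<close>
  obtain r s where rs: "r + s = d" "cps.reldim (ann_ideal f) (fitt2 f) r" "cps.reldim (fitt2 f) ?R s"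
    by (rule cps.reldim_split[OF d(2) ideal_subspace[OF An] ideal_subspace[OF fit(1)] fit(2) sub[OF fit(1)]])
  note dim_fit = reldim_imp_quot_dim[OF fit(1) one(1) rs(3)]
  \<comment> \<open>Codimension 1 leaves no room strictly between Ann(f) and the ring; both the
    Fitting ideal and the maximal ideal are proper and contain Ann(f).\<close>
  have maximal: "L = ann_ideal f" if d1: "d = 1" and L: "ideal L conv_ring" "ann_ideal f \<subseteq> L" "1 \<notin> L" for L
  proof -
    obtain r s where rs: "r + s = d" "cps.reldim (ann_ideal f) L r" "cps.reldim L ?R s"
      by (rule cps.reldim_split[OF d(2) ideal_subspace[OF An] ideal_subspace[OF L(1)] L(2) sub[OF L(1)]])
    have "s \<noteq> 0"
    proof
      assume "s = 0"
      then have "?R = L" using rs(3) cps.reldim_0 by blast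
      then show False using L(3) convergent_series_1 by blast
    qed
    then have "r = 0" using rs(1) d1 by simp
    then show ?thesis using rs(2) cps.reldim_0 by blast
  qed
  have "ann_ideal f = fitt2 f \<and> fitt2 f = max_ideal \<and> d = quot_dim (fitt2 f)" if "d = 1"
  proof -
    have eq: "fitt2 f = ann_ideal f" "max_ideal = ann_ideal f"
      using maximal[OF that fit(1,2) one(1)] maximal[OF that m _ one_m] fit(2,3) by blast+
    have "quot_dim (fitt2 f) = d"
      unfolding eq(1) by (rule reldim_imp_quot_dim(2)[OF An one(2) d(2)])
    then show ?thesis using eq by simp
  qed
  then show ?thesis
    using fit(2,3) dim_fit rs(1) diff by auto
qed

end
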